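(* Let $G$ be a simple grid graph, let $\{V_1,\dots,V_K\}$ be a partition of $V(G)$, and for each $i$ let $G_i$ be the subgraph of $G$ induced by $V_i$. Assume that each $G_i$ is a simple grid graph. Let $\mathcal{C}$ be the set of cut edges, i.e. the edges of $G$ whose two endpoints belong to different sets $V_i$, and let $C_1=\mathrm{Area}(G)+K-1$. Then $$C_1 - \frac{1}{\ln(\mathfrak{b})} \cdot \ln\left( \prod_{i=1}^K \tau(G_i) \right) \leq |\mathcal{C}| \leq C_1 - \frac{1}{\ln(4)} \cdot \ln\left( \prod_{i=1}^K \tau(G_i) \right).$$
   Context: $\tau(H)$ is the number of spanning trees of a finite connected graph $H$. The constant is $\mathfrak{b}=\exp(4C/\pi)\approx 3.2099$, where $C=\sum_{n\ge 0}\frac{(-1)^n}{(2n+1)^2}$ is Catalan's constant. $\mathcal{L}(\mathbb{Z}^2)$ is the regular square lattice graph: its vertex set is $\mathbb{Z}^2$ and its edges join points at Euclidean distance $1$. A grid graph is a finite connected subgraph of $\mathcal{L}(\mathbb{Z}^2)$; $V(G)$ denotes the vertex set of $G$. A simple closed loop in $\mathcal{L}(\mathbb{Z}^2)$ is a sequence $\alpha$ of more than two distinct vertices in which each successive pair (including the pair consisting of the first and the last) is an edge of $\mathcal{L}(\mathbb{Z}^2)$. A grid graph $G$ is simple if it consists of all of the vertices and edges of $\mathcal{L}(\mathbb{Z}^2)$ that are on and interior to a simple closed loop $\alpha$; then $\mathrm{Area}(G)$ is the area of the interior of $\alpha$ (viewed as a piecewise-linear closed curve in $\mathbb{R}^2$),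 equivalently the number of faces of $G$ (unit lattice squares enclosed by $\alpha$). *)

theory Defs
  imports "HOL-Analysis.Analysis"
begin

section \<open>Finite undirected graphs and spanning trees\<close>

text \<open>Undirected graphs without multiple edges; an edge is the set of its two endpoints.\<close>

record 'a ugraph =
  uverts :: "'a set"
  uedges :: "'a set set"

definition ugraph_connected :: "'a ugraph \<Rightarrow> bool" where
  "ugraph_connected G \<longleftrightarrow>
     uverts G \<noteq> {} \<and>
     (\<forall>u\<in>uverts G. \<forall>v\<in>uverts G. (u, v) \<in> {(x, y). {x, y} \<in> uedges G}\<^sup>*)"

definition cycle_in :: "'a set set \<Rightarrow> 'a list \<Rightarrow> bool" where
  "cycle_in E p \<longleftrightarrow>
     length p > 2 \<and> distinct p \<and>
     (\<forall>i<length p. {p ! i, p ! (Suc i mod length p)} \<in> E)"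

definition ugraph_tree :: "'a ugraph \<Rightarrow> bool" where
  "ugraph_tree G \<longleftrightarrow> ugraph_connected G \<and> (\<nexists>p. cycle_in (uedges G) p)"

definition num_spanning_trees :: "'a ugraph \<Rightarrow> nat"  (\<open>\<tau>\<close>) where
  "\<tau> G = card {T. T \<subseteq> uedges G \<and> ugraph_tree \<lparr>uverts = uverts G, uedges = T\<rparr>}"

definition induced_ugraph :: "'a ugraph \<Rightarrow> 'a set \<Rightarrow> 'a ugraph" where
  "induced_ugraph G W =
     \<lparr>uverts = uverts G \<inter> W, uedges = {e \<in> uedges G. e \<subseteq> W}\<rparr>"

definition cut_edges :: "'a ugraph \<Rightarrow> 'i set \<Rightarrow> ('i \<Rightarrow> 'a set) \<Rightarrow> 'a set set" where
  "cut_edges G I V =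
     {{u, v} |u v. {u, v} \<in> uedges G \<and> (\<exists>i\<in>I. \<exists>j\<in>I. i \<noteq> j \<and> u \<in> V i \<and> v \<in> V j)}"


section \<open>Simple grid graphs\<close>

text \<open>
  Lattice points are pairs of integers. The plane is identified isometrically with
  the type of complex numbers, for which the library states the Jordan curve theorem;
  \<open>dist\<close> and \<open>lebesgue\<close> on it are Euclidean distance and two-dimensional Lebesgue measure.
\<close>

definition pt :: "int \<times> int \<Rightarrow> complex" where
  "pt v = Complex (real_of_int (fst v)) (real_of_int (snd v))"

definition lattice_edges :: "(int \<times> int) set set" where
  "lattice_edges = {{u, v} |u v. dist (pt u) (pt v) = 1}"

definition grid_graph :: "(int \<times> int) ugraph \<Rightarrow> bool" where
  "grid_graph G \<longleftrightarrow>
     finite (uverts G) \<and> uedges G \<subseteq> lattice_edges \<and> \<Union> (uedges G) \<subseteq> uverts G \<and>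
     ugraph_connected G"

definition simple_closed_loop :: "(int \<times> int) list \<Rightarrow> bool" where
  "simple_closed_loop \<alpha> \<longleftrightarrow> cycle_in lattice_edges \<alpha>"

definition loop_curve :: "(int \<times> int) list \<Rightarrow> complex set" where
  "loop_curve \<alpha> =
     (\<Union>i<length \<alpha>. closed_segment (pt (\<alpha> ! i)) (pt (\<alpha> ! (Suc i mod length \<alpha>))))"

definition loop_area :: "(int \<times> int) list \<Rightarrow> real" where
  "loop_area \<alpha> = measure lebesgue (inside (loop_curve \<alpha>))"

definition loop_graph :: "(int \<times> int) list \<Rightarrow> (int \<times> int) ugraph" where
  "loop_graph \<alpha> =
     \<lparr>uverts = {v. pt v \<in> loop_curve \<alpha> \<union> inside (loop_curve \<alpha>)},
      uedges = {{u, v} |u v. {u, v} \<in> lattice_edges \<and>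
                  closed_segment (pt u) (pt v) \<subseteq> loop_curve \<alpha> \<union> inside (loop_curve \<alpha>)}\<rparr>"

definition bounded_by_loop :: "(int \<times> int) ugraph \<Rightarrow> (int \<times> int) list \<Rightarrow> bool" where
  "bounded_by_loop G \<alpha> \<longleftrightarrow> grid_graph G \<and> simple_closed_loop \<alpha> \<and> G = loop_graph \<alpha>"

text \<open>
  If \<open>bounded_by_loop G \<alpha>\<close> then the area of \<open>G\<close> is \<open>loop_area \<alpha>\<close>. A simple grid graph has
  many such \<open>\<alpha>\<close> (base point and orientation are free); statements involving the area
  quantify universally over \<open>\<alpha>\<close>, so that no choice of a loop is involved.
\<close>

definition simple_grid_graph :: "(int \<times> int) ugraph \<Rightarrow> bool" where
  "simple_grid_graph G \<longleftrightarrow> (\<exists>\<alpha>. bounded_by_loop G \<alpha>)"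


section \<open>Constants\<close>

definition catalan_const :: real where
  "catalan_const = (\<Sum>n. (- 1) ^ n / (2 * real n + 1)\<^sup>2)"

definition \<bb> :: real where
  "\<bb> = exp (4 * catalan_const / pi)"

end

theory Submission
  imports Defs "HOL-Real_Asymp.Real_Asymp" "Jordan_Normal_Form.Schur_Decomposition"
begin

text \<open>
  Let \<open>H\<close> be a simple grid graph with \<open>n\<close> faces. Its area is \<open>n\<close>, and Euler's relation says
  \<open>|E| + 1 = |V| + n\<close>. Adding this up over \<open>G\<close> and over the pieces \<open>G\<^sub>i\<close>, which share no vertices and
  whose edges together with the cut edges make up \<open>G\<close>, gives \<open>|C| = C\<^sub>1 - (\<Sum>i. n\<^sub>i)\<close>. Hence the theorem
  follows from \<open>\<bb> ^ n \<le> \<tau> H \<le> 4 ^ n\<close> for every simple grid graph with \<open>n\<close> faces.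

  Both estimates come from planar duality. The edges missing from a spanning tree of \<open>H\<close> form a
  spanning tree of the dual graph, in which all squares outside \<open>H\<close> are merged into one root.
  Orienting that tree towards its root means choosing, for each face, one of its four neighbouring
  squares, such that following the choices always leads out of \<open>H\<close> (\<open>ranked\<close>,
  \<open>spanning_trees_eq\<close>). There are at most \<open>4 ^ n\<close> choices. The same duality yields Euler's relation.
  It uses that every cycle of \<open>H\<close> encloses faces of \<open>H\<close> only, and that an edge separates the two
  sides of a cycle exactly if it lies on the cycle. Both follow from the Jordan curve theorem
  (\<open>border_on_loop\<close>, \<open>border_off_loop\<close>, \<open>faces_subset_of_enclosed\<close>).

  For the lower estimate, the number of good choices is the determinant of \<open>4 - A\<close>, where \<open>A\<close> is the
  adjacency matrix of the faces (\<open>rooted_matrix_tree\<close>), and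
  \<open>ln (det (1 - A / 4)) = - (\<Sum>k\<ge>1. trace ((A / 4) ^ k) / k)\<close>. The trace of \<open>A ^ k\<close> counts closed walks of
  length \<open>k\<close> that stay among the faces, so it is at most \<open>n\<close> times the number of closed walks of
  length \<open>k\<close> in the whole square lattice; for \<open>k = 2 * m\<close> the latter number is \<open>(2 * m choose m)\<^sup>2\<close>. The
  resulting series is evaluated by integrals: it is at most \<open>2 * ln 2 - 4 * catalan_const / pi\<close>
  (\<open>return_series_bound\<close>), which is \<open>ln 4 - ln \<bb>\<close>.
\<close>

section \<open>Neighbouring squares and maps that leave a region\<close>

text \<open>
  Such a rank exists if and only if iterating \<open>f\<close> from any point of \<open>F\<close> leads out of \<open>F\<close>: the number
  of steps until the exit is a rank. Stated with a rank, the property is used by looking at points of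
  least or largest rank instead of at iterates.
\<close>

definition ranked :: "'a set \<Rightarrow> ('a \<Rightarrow> 'a) \<Rightarrow> bool" where
  "ranked F f \<longleftrightarrow> (\<exists>d :: 'a \<Rightarrow> nat. \<forall>s\<in>F. f s \<in> F \<longrightarrow> d (f s) < d s)"

fun nbrs :: "int \<times> int \<Rightarrow> (int \<times> int) set" where
  "nbrs (x, y) = {(x + 1, y), (x - 1, y), (x, y + 1), (x, y - 1)}"

lemma nbrs_finite [simp]: "finite (nbrs s)" and nbrs_card [simp]: "card (nbrs s) = 4"
  by (cases s; simp)+

lemma nbrs_sym: "t \<in> nbrs s \<longleftrightarrow> s \<in> nbrs t"
  by (cases s; cases t) auto

section \<open>Return probabilities and Catalan's constant\<close>

text \<open>
  The probability that the simple random walk on the integers is back at its start after \<open>2 * m\<close> steps.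
  It is also the mean of \<open>sin t ^ (2 * m)\<close>, and the coefficient of \<open>y ^ m\<close> in \<open>1 / sqrt (1 - y)\<close>; the
  square of it, the return probability of the walk in the plane, is summed by combining the two.
\<close>

definition return_prob :: "nat \<Rightarrow> real" where
  "return_prob m = real ((2 * m) choose m) / 4 ^ m"

lemma return_prob_0 [simp]: "return_prob 0 = 1"
  by (simp add: return_prob_def)

lemma return_prob_nonneg: "0 \<le> return_prob m"
  by (simp add: return_prob_def)

lemma return_prob_Suc: "return_prob (Suc m) = (2 * real m + 1) / (2 * real m + 2) * return_prob m"
proof -
  have f: "real ((2 * n) choose n) = fact (2 * n) / (fact n * fact n)" for n
    using binomial_fact[of n "2 * n", where 'a = real] by simp
  have "(fact (2 * Suc m) :: real) = (2 * real m + 2) * (2 * real m + 1) * fact (2 * m)"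
    by (simp add: algebra_simps)
  then show ?thesis
    unfolding return_prob_def f by (simp add: divide_simps) (simp add: algebra_simps)
qed

text \<open>
  Induction by Wallis' recurrence, which expresses that \<open>sin t ^ (2 * m + 1) * cos t\<close> vanishes at both
  ends of the interval.
\<close>

lemma integral_sin_even:
  "((\<lambda>t. sin t ^ (2 * m)) has_integral (pi / 2 * return_prob m)) {0..pi/2}"
proof (induction m)
  case 0
  show ?case using has_integral_const_real[of "1::real" 0 "pi/2"] by simp
next
  case (Suc m)
  have "((\<lambda>t. (2 * real m + 1) * sin t ^ (2 * m) - (2 * real m + 2) * sin t ^ (2 * Suc m))
          has_integral (sin (pi/2) ^ (2 * m + 1) * cos (pi/2) - sin 0 ^ (2 * m + 1) * cos 0)) {0..pi/2}"
  proof (rule fundamental_theorem_of_calculus)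
    fix t :: real
    have "((\<lambda>t. sin t ^ (2 * m + 1) * cos t) has_real_derivative
            (2 * real m + 1) * sin t ^ (2 * m) * cos t * cos t - sin t ^ (2 * m + 1) * sin t) (at t)"
      by (rule derivative_eq_intros refl | simp)+
    moreover have "(2 * real m + 1) * sin t ^ (2 * m) * cos t * cos t - sin t ^ (2 * m + 1) * sin t
        = (2 * real m + 1) * sin t ^ (2 * m) - (2 * real m + 2) * sin t ^ (2 * Suc m)"
    proof -
      have c: "cos t * cos t = 1 - sin t * sin t"
        using sin_cos_squared_add[of t] by (simp add: power2_eq_square)
      have "(2 * real m + 1) * sin t ^ (2 * m) * (cos t * cos t) - sin t ^ (2 * m + 1) * sin t
        = (2 * real m + 1) * sin t ^ (2 * m) - (2 * real m + 2) * sin t ^ (2 * Suc m)"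
        unfolding c by (simp add: algebra_simps)
      then show ?thesis by (simp only: mult.assoc)
    qed
    ultimately show "((\<lambda>t. sin t ^ (2 * m + 1) * cos t) has_vector_derivative
        ((2 * real m + 1) * sin t ^ (2 * m) - (2 * real m + 2) * sin t ^ (2 * Suc m)))
        (at t within {0..pi/2})"
      by (simp only: has_real_derivative_iff_has_vector_derivative[symmetric] has_field_derivative_at_within)
  qed simp
  then have 0: "((\<lambda>t. (2 * real m + 1) * sin t ^ (2 * m) - (2 * real m + 2) * sin t ^ (2 * Suc m))
          has_integral 0) {0..pi/2}" by simp
  have "((\<lambda>t. ((2 * real m + 1) * sin t ^ (2 * m) -
      ((2 * real m + 1) * sin t ^ (2 * m) - (2 * real m + 2) * sin t ^ (2 * Suc m))) / (2 * real m + 2))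
      has_integral (((2 * real m + 1) * (pi / 2 * return_prob m) - 0) / (2 * real m + 2))) {0..pi/2}"
    by (intro has_integral_divide has_integral_diff has_integral_mult_right Suc 0)
  moreover have "((2 * real m + 1) * x - ((2 * real m + 1) * x - (2 * real m + 2) * y)) / (2 * real m + 2) = y"
    for x y :: real
    by (simp add: divide_simps)
  ultimately show ?case
    by (simp only: return_prob_Suc) (simp add: mult_ac)
qed

lemma return_prob_gbinomial: "return_prob m = (- (1/2) gchoose m) * (-1) ^ m"
proof (induction m)
  case (Suc m)
  have "(- (1/2 :: real) gchoose Suc m) = (- (1/2) - real m) / (real m + 1) * (- (1/2) gchoose m)"
    by (simp add: gbinomial_prod_rev divide_simps mult_ac)
  then have "(- (1/2 :: real) gchoose Suc m) * (-1) ^ Suc m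
      = (2 * real m + 1) / (2 * real m + 2) * ((- (1/2) gchoose m) * (-1) ^ m)"
    by (simp only: power_Suc) (simp add: divide_simps, simp add: algebra_simps)
  then show ?case unfolding return_prob_Suc Suc by simp
qed simp

lemma return_prob_generating_bound:
  assumes "0 \<le> y" "y < 1"
  shows "(\<Sum>m\<le>M. return_prob m * y ^ m) \<le> 1 / sqrt (1 - y)"
proof -
  have "(\<lambda>n. (- (1/2) gchoose n) * (- y) ^ n) sums (1 + (- y)) powr (- (1/2))"
    by (rule gen_binomial_real) (use assms in auto)
  then have "(\<lambda>n. return_prob n * y ^ n) sums (1 - y) powr (- (1/2))"
    by (simp add: return_prob_gbinomial power_minus[of y] mult_ac)
  then have "(\<Sum>m\<le>M. return_prob m * y ^ m) \<le> (1 - y) powr (- (1/2))"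
    using sum_le_suminf[of "\<lambda>n. return_prob n * y ^ n" "{..M}"] assms
    by (auto simp: sums_iff return_prob_nonneg)
  then show ?thesis using assms by (simp add: powr_minus powr_half_sqrt field_simps)
qed

text \<open>
  Subtracting the constant term from the bound on the generating function, dividing by \<open>y\<close> and
  integrating gives a logarithm. With
  \<open>y = (sin t)\<^sup>2\<close> this becomes a comparison of derivatives in \<open>t\<close>.
\<close>

lemma return_prob_log_bound:
  assumes "0 \<le> t" "t \<le> pi/2"
  shows "(\<Sum>m=1..M. return_prob m * sin t ^ (2 * m) / (2 * real m)) \<le> ln 2 - ln (1 + cos t)"
proof -
  define k where "k = (\<lambda>t. ln 2 - ln (1 + cos t) - (\<Sum>m=1..M. return_prob m * sin t ^ (2 * m) / (2 * real m)))"
  define k' where "k' = (\<lambda>t. sin t / (1 + cos t) - (\<Sum>m=1..M. return_prob m * sin t ^ (2 * m - 1) * cos t))"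
  have "k 0 \<le> k t"
  proof (rule DERIV_nonneg_imp_nondecreasing[OF assms(1)], rule exI, rule conjI)
    fix x assume x: "0 \<le> x" "x \<le> t"
    have c: "0 \<le> cos x" using x assms by (intro cos_ge_zero) auto
    have s: "0 \<le> sin x" using x assms by (intro sin_ge_zero) auto
    show "(k has_real_derivative k' x) (at x)"
      unfolding k_def k'_def using c
      by (auto intro!: derivative_eq_intros DERIV_sum sum.cong simp: field_simps)
    show "0 \<le> k' x"
    proof (cases "sin x = 0 \<or> cos x = 0")
      case True
      moreover have "return_prob m * sin x ^ (2 * m - 1) * cos x = 0" if "m \<in> {1..M}" for m
        using True that by auto
      ultimately show ?thesis unfolding k'_def using s c by (simp add: sum.neutral)
    next
      case False
      with s c have sp: "0 < sin x" and cp: "0 < cos x" by auto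
      have sq: "1 - sin x ^ 2 = cos x ^ 2" by (simp add: cos_squared_eq)
      have "sin x ^ 2 < 1" using sq cp by (smt (verit) zero_less_power)
      then have "(\<Sum>m\<le>M. return_prob m * (sin x ^ 2) ^ m) \<le> 1 / sqrt (1 - sin x ^ 2)"
        by (intro return_prob_generating_bound) auto
      then have 1: "(\<Sum>m\<le>M. return_prob m * sin x ^ (2 * m)) \<le> 1 / cos x"
        unfolding sq using c by (simp add: power_mult)
      have "(\<Sum>m\<le>M. return_prob m * sin x ^ (2 * m)) = 1 + (\<Sum>m=1..M. return_prob m * sin x ^ (2 * m))"
      proof -
        have "{..M} = insert 0 {1..M}" by auto
        then show ?thesis by simp
      qed
      with 1 have "(\<Sum>m=1..M. return_prob m * sin x ^ (2 * m)) * cos x \<le> (1 / cos x - 1) * cos x"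
        using c by (intro mult_right_mono) auto
      also have "\<dots> = 1 - cos x" using cp by (simp add: field_simps)
      also have "\<dots> = sin x * (sin x / (1 + cos x))"
      proof -
        have "(1 - cos x) * (1 + cos x) = sin x * sin x"
          using sin_squared_eq[of x] by (simp add: algebra_simps power2_eq_square)
        then show ?thesis using cp by (simp add: field_simps)
      qed
      also have "(\<Sum>m=1..M. return_prob m * sin x ^ (2 * m)) * cos x =
          sin x * (\<Sum>m=1..M. return_prob m * sin x ^ (2 * m - 1) * cos x)"
        unfolding sum_distrib_left sum_distrib_right
      proof (rule sum.cong[OF refl])
        fix m assume "m \<in> {1..M}"
        then have "sin x ^ (2 * m) = sin x * sin x ^ (2 * m - 1)"
          by (subst power_Suc[symmetric]) (auto simp: Suc_diff_le)
        then show "return_prob m * sin x ^ (2 * m) * cos x = sin x * (return_prob m * sin x ^ (2 * m - 1) * cos x)"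
          by simp
      qed
      finally show ?thesis unfolding k'_def
        using mult_le_cancel_left_pos[OF sp] by (metis diff_ge_0_iff_ge)
    qed
  qed
  moreover have "k 0 = 0" unfolding k_def by (auto intro!: sum.neutral)
  ultimately show ?thesis unfolding k_def by simp
qed

text \<open>
  The real part of the power series of \<open>Ln (1 + z)\<close> at \<open>z = r * cis t\<close>.
\<close>

lemma log_kernel_series:
  assumes "0 < r" "r < 1"
  shows "(\<lambda>n. (-1) ^ Suc n / real n * r ^ n * cos (real n * t)) sums (ln (1 + 2 * r * cos t + r\<^sup>2) / 2)"
proof -
  define z where "z = complex_of_real r * cis t"
  have nz: "norm z < 1" using assms by (simp add: z_def norm_mult)
  have "(\<lambda>n. (-1) ^ Suc n / of_nat n * z ^ n) sums Ln (1 + z)"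
    by (rule Ln_series[OF nz])
  then have "(\<lambda>n. Re ((-1) ^ Suc n / of_nat n * z ^ n)) sums Re (Ln (1 + z))"
    by (rule sums_Re)
  moreover have "Re ((-1) ^ Suc n / of_nat n * z ^ n) = (-1) ^ Suc n / real n * r ^ n * cos (real n * t)" for n
  proof -
    have "(-1) ^ Suc n / of_nat n * z ^ n = complex_of_real ((-1) ^ Suc n / real n * r ^ n) * cis (real n * t)"
      by (simp add: z_def power_mult_distrib Complex.DeMoivre)
    then show ?thesis by (simp only:) simp 
  qed
  moreover have "Re (Ln (1 + z)) = ln (1 + 2 * r * cos t + r\<^sup>2) / 2"
  proof -
    have ne: "1 + z \<noteq> 0"
    proof
      assume "1 + z = 0"
      then have "z = -1" by (simp add: eq_neg_iff_add_eq_0 add.commute)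
      then show False using nz by simp
    qed
    have "(norm (1 + z))\<^sup>2 = 1 + 2 * r * cos t + r\<^sup>2"
    proof -
      have "(norm (1 + z))\<^sup>2 = (1 + r * cos t)\<^sup>2 + (r * sin t)\<^sup>2"
        by (simp add: cmod_power2 z_def)
      also have "\<dots> = 1 + 2 * r * cos t + r\<^sup>2 * ((cos t)\<^sup>2 + (sin t)\<^sup>2)"
        by (simp only: power2_sum power_mult_distrib distrib_left) simp
      finally show ?thesis by simp
    qed
    then have "norm (1 + z) = sqrt (1 + 2 * r * cos t + r\<^sup>2)"
      by (metis norm_ge_zero real_sqrt_unique)
    moreover from this ne have "0 < 1 + 2 * r * cos t + r\<^sup>2"
      by (metis real_sqrt_gt_0_iff zero_less_norm_iff)
    ultimately show ?thesis using ne by (simp add: Re_Ln ln_sqrt)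
  qed
  ultimately show ?thesis by (simp only:)
qed

text \<open>
  Termwise integration of \<open>log_kernel_series\<close> over a quarter period, where
  \<open>1 + 2 * r * cos t + r\<^sup>2 \<le> 2 + 2 * cos t\<close> because the cosine is nonnegative. This comparison
  replaces a passage to the limit \<open>r = 1\<close> under the integral.
\<close>

lemma abel_integral_bound:
  assumes r: "0 < r" "r < 1"
  shows "(\<Sum>n. (-1) ^ Suc n * sin (real n * (pi / 2)) / (real n)\<^sup>2 * r ^ n)
           \<le> integral {0..pi/2} (\<lambda>t. ln (2 + 2 * cos t)) / 2"
proof -
  define f where "f = (\<lambda>n t. (-1) ^ Suc n / real n * r ^ n * cos (real n * t))"
  have ul: "uniform_limit {0..pi/2} (\<lambda>n t. \<Sum>i<n. f i t) (\<lambda>t. suminf (\<lambda>i. f i t)) sequentially"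
  proof (rule Weierstrass_m_test)
    show "summable (\<lambda>n. r ^ n)" using r by (simp add: summable_geometric)
    fix n t
    have "norm (f n t) = 1 / real n * r ^ n * \<bar>cos (real n * t)\<bar>"
      using r by (simp add: f_def abs_mult power_abs)
    also have "\<dots> \<le> 1 * r ^ n * 1"
      using r by (intro mult_mono) (auto simp: divide_simps)
    finally show "norm (f n t) \<le> r ^ n" by simp
  qed
  obtain I J where I: "\<And>n. ((\<lambda>t. \<Sum>i<n. f i t) has_integral I n) {0..pi/2}"
    and J: "((\<lambda>t. suminf (\<lambda>i. f i t)) has_integral J) {0..pi/2}" and lim: "I \<longlonglongrightarrow> J"
  proof (rule uniform_limit_integral[OF ul])
    show "continuous_on {0..pi/2} (\<lambda>t. \<Sum>i<n. f i t)" for n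
      unfolding f_def
      by (intro continuous_on_sum continuous_on_mult continuous_on_cos continuous_on_const continuous_on_id)
  qed auto
  have "(f n has_integral ((-1) ^ Suc n * sin (real n * (pi / 2)) / (real n)\<^sup>2 * r ^ n)) {0..pi/2}" for n
  proof (cases "n = 0")
    case False
    have "(f n has_integral ((-1) ^ Suc n / real n * r ^ n * (sin (real n * (pi/2)) / real n)
         - (-1) ^ Suc n / real n * r ^ n * (sin (real n * 0) / real n))) {0..pi/2}"
      unfolding f_def
    proof (rule fundamental_theorem_of_calculus)
      fix t :: real
      have "((\<lambda>t. (-1) ^ Suc n / real n * r ^ n * (sin (real n * t) / real n)) has_real_derivative
         (-1) ^ Suc n / real n * r ^ n * cos (real n * t)) (at t within {0..pi/2})"
        using False by (auto intro!: derivative_eq_intros)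
      then show "((\<lambda>t. (-1) ^ Suc n / real n * r ^ n * (sin (real n * t) / real n)) has_vector_derivative
         (-1) ^ Suc n / real n * r ^ n * cos (real n * t)) (at t within {0..pi/2})"
        by (simp only: has_real_derivative_iff_has_vector_derivative)
    qed simp
    then show ?thesis by (rule has_integral_eq_rhs) (simp add: power2_eq_square)
  qed (simp add: f_def)
  then have "((\<lambda>t. \<Sum>i<n. f i t) has_integral
      (\<Sum>i<n. (-1) ^ Suc i * sin (real i * (pi / 2)) / (real i)\<^sup>2 * r ^ i)) {0..pi/2}" for n
    by (intro has_integral_sum) auto
  then have "I = (\<lambda>n. \<Sum>i<n. (-1) ^ Suc i * sin (real i * (pi / 2)) / (real i)\<^sup>2 * r ^ i)"
    using I has_integral_unique by blast
  with lim have sumJ: "(\<lambda>i. (-1) ^ Suc i * sin (real i * (pi / 2)) / (real i)\<^sup>2 * r ^ i) sums J"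
    by (simp add: sums_def)
  have val: "suminf (\<lambda>i. f i t) = ln (1 + 2 * r * cos t + r\<^sup>2) / 2" for t
    using log_kernel_series[OF r, of t] by (simp add: f_def sums_iff)
  have cnn: "0 \<le> cos t" if "t \<in> {0..pi/2}" for t
    using that by (intro cos_ge_zero) auto
  have "((\<lambda>t. ln (2 + 2 * cos t)) has_integral integral {0..pi/2} (\<lambda>t. ln (2 + 2 * cos t))) {0..pi/2}"
    using cnn by (intro integrable_integral integrable_continuous_interval continuous_intros) force
  then have "((\<lambda>t. ln (2 + 2 * cos t) / 2) has_integral
      integral {0..pi/2} (\<lambda>t. ln (2 + 2 * cos t)) / 2) {0..pi/2}"
    by (rule has_integral_divide)
  from J this have "J \<le> integral {0..pi/2} (\<lambda>t. ln (2 + 2 * cos t)) / 2"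
  proof (rule has_integral_le)
    fix t assume t: "t \<in> {0..pi/2}"
    have "1 + 2 * r * cos t + r\<^sup>2 \<le> 2 + 2 * cos t"
    proof -
      have "r * cos t \<le> 1 * cos t" using r cnn[OF t] by (intro mult_right_mono) auto
      moreover have "r\<^sup>2 \<le> 1" using r by (simp add: power_le_one)
      ultimately show ?thesis by simp
    qed
    moreover have "0 < 1 + 2 * r * cos t + r\<^sup>2"
      using r cnn[OF t] by (intro add_pos_nonneg add_pos_nonneg) auto
    ultimately show "suminf (\<lambda>i. f i t) \<le> ln (2 + 2 * cos t) / 2"
      unfolding val by simp
  qed
  then show ?thesis using sumJ by (simp add: sums_iff)
qed

text \<open>
  The sines vanish at even indices and alternate in sign at odd ones.
\<close>

lemma catalan_odd_series:
  "(\<lambda>n. (-1) ^ Suc n * sin (real n * (pi / 2)) / (real n)\<^sup>2) sums catalan_const"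
proof -
  let ?f = "\<lambda>n. (-1) ^ Suc n * sin (real n * (pi / 2)) / (real n)\<^sup>2"
  have sm: "summable ?f"
  proof (rule summable_comparison_test'[where N = 0])
    show "summable (\<lambda>n. 1 / (real n)\<^sup>2)"
      using inverse_power_summable[of 2, where 'a = real] by (simp add: inverse_eq_divide)
    show "norm (?f n) \<le> 1 / (real n)\<^sup>2" for n
      by (simp add: abs_mult power_abs divide_right_mono)
  qed
  have z: "?f n = 0" if "n \<notin> range (\<lambda>j. 2 * j + 1)" for n
  proof -
    have "even n" using that by (metis oddE rangeI)
    then obtain k where "n = 2 * k" by blast
    then have "sin (real n * (pi / 2)) = 0" by (simp add: mult.commute)
    then show ?thesis by simp
  qed
  have "(\<lambda>j. ?f (2 * j + 1)) sums suminf ?f"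
    using sums_mono_reindex[of "\<lambda>j. 2 * j + 1" ?f] z summable_sums[OF sm]
    by (auto simp: strict_mono_def)
  moreover have "?f (2 * j + 1) = (-1) ^ j / (2 * real j + 1)\<^sup>2" for j
  proof -
    have "sin (real (2 * j + 1) * (pi / 2)) = sin (real j * pi + pi / 2)"
      by (simp add: algebra_simps add_divide_distrib)
    also have "\<dots> = (-1) ^ j" by (simp add: sin_add)
    finally show ?thesis by simp
  qed
  ultimately show ?thesis
    using summable_sums[OF sm] by (simp add: catalan_const_def sums_iff)
qed

lemma integral_log_cos_bound:
  "2 * catalan_const \<le> integral {0..pi/2} (\<lambda>t. ln (2 + 2 * cos t))"
proof -
  let ?c = "\<lambda>n. (-1) ^ Suc n * sin (real n * (pi / 2)) / (real n)\<^sup>2"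
  let ?g = "\<lambda>r. \<Sum>n. ?c n * r ^ n"
  have "continuous_on {0..1} ?g"
  proof (rule uniform_limit_theorem)
    show "uniform_limit {0..1} (\<lambda>n r. \<Sum>i<n. ?c i * r ^ i) ?g sequentially"
    proof (rule Weierstrass_m_test)
      show "summable (\<lambda>n. 1 / (real n)\<^sup>2)"
        using inverse_power_summable[of 2, where 'a = real] by (simp add: inverse_eq_divide)
      fix n and r :: real assume r: "r \<in> {0..1}"
      have "norm (?c n * r ^ n) = \<bar>sin (real n * (pi / 2))\<bar> * r ^ n / (real n)\<^sup>2"
        using r by (simp add: abs_mult power_abs)
      also have "\<dots> \<le> 1 * 1 / (real n)\<^sup>2"
        using r by (intro divide_right_mono mult_mono) (auto simp: power_le_one)
      finally show "norm (?c n * r ^ n) \<le> 1 / (real n)\<^sup>2" by simp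
    qed
    show "\<forall>\<^sub>F n in sequentially. continuous_on {0..1} (\<lambda>r. \<Sum>i<n. ?c i * r ^ i)"
      by (intro always_eventually allI continuous_on_sum continuous_on_mult continuous_on_const
          continuous_on_power continuous_on_id)
  qed simp
  moreover have "(\<lambda>k. 1 - 1 / (real k + 2)) \<longlonglongrightarrow> 1"
    by real_asymp
  ultimately have "(\<lambda>k. ?g (1 - 1 / (real k + 2))) \<longlonglongrightarrow> ?g 1"
    by (rule continuous_on_tendsto_compose) (simp_all add: divide_simps)
  then have "?g 1 \<le> integral {0..pi/2} (\<lambda>t. ln (2 + 2 * cos t)) / 2"
  proof (rule LIMSEQ_le_const2)
    have "?g (1 - 1 / (real k + 2)) \<le> integral {0..pi/2} (\<lambda>t. ln (2 + 2 * cos t)) / 2" for k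
      by (rule abel_integral_bound) (simp_all add: divide_simps)
    then show "\<exists>N. \<forall>k\<ge>N. ?g (1 - 1 / (real k + 2)) \<le> integral {0..pi/2} (\<lambda>t. ln (2 + 2 * cos t)) / 2"
      by blast
  qed
  moreover have "?g 1 = catalan_const"
    using catalan_odd_series by (simp only: sums_iff power_one mult_1_right)
  ultimately show ?thesis by simp
qed

text \<open>
  One factor of \<open>(return_prob m)\<^sup>2\<close> is written as an integral of \<open>sin t ^ (2 * m)\<close>; the sum over \<open>m\<close> can then be
  bounded under the integral by \<open>return_prob_log_bound\<close>.
\<close>

lemma return_series_bound:
  "(\<Sum>m=1..M. (return_prob m)\<^sup>2 / (2 * real m)) \<le> 2 * ln 2 - 4 * catalan_const / pi"
proof -
  have cnn: "0 \<le> cos t" if "t \<in> {0..pi/2}" for t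
    using that by (intro cos_ge_zero) auto
  \<comment> \<open>The integral of the partial sum is \<open>pi / 2\<close> times the partial sum to be bounded.\<close>
  have 1: "((\<lambda>t. \<Sum>m=1..M. return_prob m / (2 * real m) * sin t ^ (2 * m)) has_integral
      (\<Sum>m=1..M. return_prob m / (2 * real m) * (pi / 2 * return_prob m))) {0..pi/2}"
    by (intro has_integral_sum has_integral_mult_right integral_sin_even) auto
  have int: "((\<lambda>t. ln (2 + 2 * cos t)) has_integral integral {0..pi/2} (\<lambda>t. ln (2 + 2 * cos t))) {0..pi/2}"
    using cnn by (intro integrable_integral integrable_continuous_interval continuous_intros) force
  \<comment> \<open>This integrand is \<open>ln 2 - ln (1 + cos t)\<close>, the bound of \<open>return_prob_log_bound\<close>.\<close>
  have 2: "((\<lambda>t. 2 * ln 2 - ln (2 + 2 * cos t)) has_integral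
      ((pi / 2) * (2 * ln 2) - integral {0..pi/2} (\<lambda>t. ln (2 + 2 * cos t)))) {0..pi/2}"
    using has_integral_diff[OF has_integral_const_real[of "2 * ln 2" 0 "pi/2"] int] by simp
  from 1 2 have "(\<Sum>m=1..M. return_prob m / (2 * real m) * (pi / 2 * return_prob m))
      \<le> (pi / 2) * (2 * ln 2) - integral {0..pi/2} (\<lambda>t. ln (2 + 2 * cos t))"
  proof (rule has_integral_le)
    fix t :: real assume t: "t \<in> {0..pi/2}"
    have "ln (2 + 2 * cos t) = ln (2 * (1 + cos t))" by (simp add: algebra_simps)
    also have "\<dots> = ln 2 + ln (1 + cos t)" using cnn[OF t] by (intro ln_mult_pos) auto
    finally show "(\<Sum>m=1..M. return_prob m / (2 * real m) * sin t ^ (2 * m)) \<le> 2 * ln 2 - ln (2 + 2 * cos t)"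
      using return_prob_log_bound[of t M] t by simp
  qed
  also have "\<dots> \<le> (pi / 2) * (2 * ln 2) - 2 * catalan_const"
    using integral_log_cos_bound by simp
  also have "(\<Sum>m=1..M. return_prob m / (2 * real m) * (pi / 2 * return_prob m)) =
      (pi / 2) * (\<Sum>m=1..M. (return_prob m)\<^sup>2 / (2 * real m))"
    unfolding sum_distrib_left by (intro sum.cong) (auto simp: power2_eq_square)
  also have "(pi / 2) * (2 * ln 2) - 2 * catalan_const = (pi / 2) * (2 * ln 2 - 4 * catalan_const / pi)"
    by (simp add: algebra_simps)
  finally show ?thesis by simp
qed

section \<open>A determinant that counts ranked maps\<close>

text \<open>
  The matrix \<open>1 - P\<close>, where \<open>P\<close> is the transition matrix of the map \<open>f\<close> on the points \<open>e 0, ..., e (n - 1)\<close>;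
  a point that \<open>f\<close> sends elsewhere has a zero row in \<open>P\<close>.
\<close>

definition map_laplacian :: "nat \<Rightarrow> (nat \<Rightarrow> 'a) \<Rightarrow> ('a \<Rightarrow> 'a) \<Rightarrow> complex mat" where
  "map_laplacian n e f =
     mat n n (\<lambda>(i, j). (if i = j then 1 else 0) - (if f (e i) = e j then 1 else 0))"

text \<open>
  If a permutation contributes to the determinant, then it acts like \<open>f\<close> on the indices it moves, so it
  lowers their rank. A moved index of least rank would be sent to a moved index of even smaller rank;
  hence only the identity contributes.
\<close>

lemma det_map_laplacian_ranked:
  assumes inj: "inj_on e {0..<n}" and rk: "ranked (e ` {0..<n}) f"
  shows "det (map_laplacian n e f) = 1"
proof -
  let ?D = "map_laplacian n e f"
  obtain d :: "'a \<Rightarrow> nat" where d: "\<And>s. s \<in> e ` {0..<n} \<Longrightarrow> f s \<in> e ` {0..<n} \<Longrightarrow> d (f s) < d s"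
    using rk unfolding ranked_def by blast
  have zero: "(\<Prod>i = 0..<n. ?D $$ (i, p i)) = 0" if p: "p permutes {0..<n}" "p \<noteq> id" for p
  proof (rule ccontr)
    assume nz: "(\<Prod>i = 0..<n. ?D $$ (i, p i)) \<noteq> 0"
    have step: "d (e (p i)) < d (e i)" if i: "i < n" "p i \<noteq> i" for i
    proof -
      have pi: "p i < n" using permutes_in_image[OF p(1), of i] i by simp
      have "?D $$ (i, p i) \<noteq> 0" using nz i by simp
      then have "f (e i) = e (p i)"
        using i pi by (auto simp: map_laplacian_def split: if_splits)
      then show ?thesis using d[of "e i"] i pi by simp
    qed
    obtain i0 where i0: "p i0 \<noteq> i0" using p(2) by (auto simp: fun_eq_iff)
    then have "i0 < n" using p(1) by (metis permutes_not_in atLeastLessThan_iff zero_le)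
    with i0 have "\<exists>i. i < n \<and> p i \<noteq> i" by blast
    then obtain i where i: "i < n" "p i \<noteq> i"
      and min: "\<And>j. j < n \<Longrightarrow> p j \<noteq> j \<Longrightarrow> d (e i) \<le> d (e j)"
      using exists_least_iff[of "\<lambda>k. \<exists>i. i < n \<and> p i \<noteq> i \<and> d (e i) = k"] by (metis not_le)
    have "p i < n" using permutes_in_image[OF p(1), of i] i by simp
    moreover have "p (p i) \<noteq> p i" using permutes_inj[OF p(1)] i(2) by (metis injD)
    ultimately show False using min[of "p i"] step[OF i] by simp
  qed
  have "det ?D = (\<Sum>p\<in>{p. p permutes {0..<n}}. signof p * (\<Prod>i = 0..<n. ?D $$ (i, p i)))"
    by (rule det_def') (simp add: map_laplacian_def)
  also have "\<dots> = (\<Sum>p\<in>{id}. signof p * (\<Prod>i = 0..<n. ?D $$ (i, p i)))"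
    by (rule sum.mono_neutral_right) (auto simp: finite_permutations zero permutes_id)
  also have "\<dots> = (\<Prod>i = 0..<n. ?D $$ (i, i))" by (simp add: sign_id)
  also have "\<dots> = 1"
  proof (rule prod.neutral, rule ballI)
    fix i assume i: "i \<in> {0..<n}"
    then have "f (e i) \<noteq> e i" using d[of "e i"] by auto
    then show "?D $$ (i, i) = 1" using i by (simp add: map_laplacian_def)
  qed
  finally show ?thesis .
qed

text \<open>
  The points from which iterating \<open>f\<close> never leaves form a nonempty set that is preserved by \<open>f\<close> in both
  directions, so its indicator vector lies in the kernel.
\<close>

lemma det_map_laplacian_not_ranked:
  assumes inj: "inj_on e {0..<n}" and nrk: "\<not> ranked (e ` {0..<n}) f"
  shows "det (map_laplacian n e f) = 0"
proof -
  let ?F = "e ` {0..<n}" and ?D = "map_laplacian n e f"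
  define Z where "Z = {s \<in> ?F. \<forall>k. (f ^^ k) s \<in> ?F}"
  have Zstep: "s \<in> Z \<longleftrightarrow> f s \<in> Z" if "s \<in> ?F" for s
  proof
    assume "s \<in> Z"
    then have "(f ^^ Suc k) s \<in> ?F" for k unfolding Z_def by blast
    from this[unfolded funpow_Suc_right o_def] this[of 0] show "f s \<in> Z" unfolding Z_def by auto
  next
    assume "f s \<in> Z"
    then have "(f ^^ Suc k) s \<in> ?F" for k unfolding Z_def funpow_Suc_right o_def by blast
    then have "(f ^^ k) s \<in> ?F" for k using that by (cases k) auto
    then show "s \<in> Z" unfolding Z_def using that by auto
  qed
  have "Z \<noteq> {}"
  proof
    assume Z: "Z = {}"
    define d where "d = (\<lambda>s. LEAST k. (f ^^ k) s \<notin> ?F)"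
    have "d (f s) < d s" if s: "s \<in> ?F" for s
    proof -
      have "\<exists>k. (f ^^ k) s \<notin> ?F" using Z s unfolding Z_def by blast
      then have ex: "(f ^^ d s) s \<notin> ?F" unfolding d_def by (rule LeastI_ex)
      then obtain k where k: "d s = Suc k" using s by (cases "d s") auto
      have "(f ^^ k) (f s) \<notin> ?F" using ex unfolding k funpow_Suc_right by simp
      then have "d (f s) \<le> k" unfolding d_def by (rule Least_le)
      then show ?thesis using k by simp
    qed
    then have "ranked ?F f" unfolding ranked_def by blast
    then show False using nrk by simp
  qed
  then obtain z where z: "z < n" "e z \<in> Z" unfolding Z_def by auto
  define v where "v = vec n (\<lambda>i. if e i \<in> Z then 1 else (0 :: complex))"
  have v: "v \<in> carrier_vec n" by (simp add: v_def)
  have D: "?D \<in> carrier_mat n n" by (simp add: map_laplacian_def)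
  have "v $ z = 1" using z by (simp add: v_def)
  then have "v \<noteq> 0\<^sub>v n" using z by auto
  moreover have "?D *\<^sub>v v = 0\<^sub>v n"
  proof (rule eq_vecI)
    fix i assume "i < dim_vec (0\<^sub>v n :: complex vec)"
    then have i: "i < n" by simp
    have "(?D *\<^sub>v v) $ i = (\<Sum>j\<in>{0..<n}. ?D $$ (i, j) * v $ j)"
      using i D v by (simp add: mult_mat_vec_def scalar_prod_def)
    also have "\<dots> = (\<Sum>j\<in>{0..<n}. (if j = i then v $ j else 0)) - (\<Sum>j\<in>{0..<n}. (if e j = f (e i) then v $ j else 0))"
      unfolding sum_subtractf[symmetric]
      by (rule sum.cong[OF refl]) (use i in \<open>auto simp: map_laplacian_def\<close>)
    also have "(\<Sum>j\<in>{0..<n}. (if j = i then v $ j else 0)) = v $ i" using i by simp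
    also have "(\<Sum>j\<in>{0..<n}. (if e j = f (e i) then v $ j else 0)) = (if f (e i) \<in> Z then 1 else 0)"
    proof (cases "f (e i) \<in> ?F")
      case True
      then obtain l where l: "l < n" "f (e i) = e l" by auto
      have "(\<Sum>j\<in>{0..<n}. (if e j = f (e i) then v $ j else 0)) = (\<Sum>j\<in>{0..<n}. (if j = l then v $ j else 0))"
        using l inj by (intro sum.cong) (auto simp: inj_on_def)
      then show ?thesis using l by (simp add: v_def)
    next
      case False
      then have "e j \<noteq> f (e i)" if "j \<in> {0..<n}" for j using that by (metis imageI)
      then have "(\<Sum>j\<in>{0..<n}. (if e j = f (e i) then v $ j else 0)) = 0" by (intro sum.neutral) auto
      moreover have "f (e i) \<notin> Z" using False unfolding Z_def by blast
      ultimately show ?thesis by simp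
    qed
    also have "v $ i - (if f (e i) \<in> Z then 1 else 0) = 0"
      using Zstep[of "e i"] i by (simp add: v_def)
    finally show "(?D *\<^sub>v v) $ i = 0\<^sub>v n $ i" using i by simp
  qed (use D in simp)
  ultimately show ?thesis using v det_0_iff_vec_prod_zero[OF D] by blast
qed

text \<open>
  The matrix tree theorem for forests rooted outside \<open>F\<close>. Row \<open>s\<close> of the matrix is a sum over the
  neighbours \<open>t\<close> of \<open>s\<close>, the summand being the row of a map that sends \<open>s\<close> to \<open>t\<close>. By multilinearity in the
  rows the determinant is a sum over all maps, and each of them contributes \<open>1\<close> or \<open>0\<close>.
\<close>

lemma rooted_matrix_tree:
  assumes bij: "bij_betw e {0..<n} F" and fin: "\<And>s. s \<in> F \<Longrightarrow> finite (nb s)"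
  shows "det (mat n n (\<lambda>(i, j). (if i = j then of_nat (card (nb (e i))) else 0) -
            (if e j \<in> nb (e i) then 1 else 0))) = (of_nat (card {f \<in> PiE F nb. ranked F f}) :: complex)"
    (is "det ?L = _")
proof -
  let ?D = "map_laplacian n e"
  define \<iota> where "\<iota> = the_inv_into {0..<n} e"
  have inj: "inj_on e {0..<n}" and F: "F = e ` {0..<n}"
    using bij by (auto simp: bij_betw_def)
  have \<iota>: "\<iota> (e i) = i" if "i \<in> {0..<n}" for i
    unfolding \<iota>_def by (rule the_inv_into_f_f[OF inj that])
  define h :: "nat \<Rightarrow> nat \<Rightarrow> 'a \<Rightarrow> complex"
    where "h = (\<lambda>i j t. (if i = j then 1 else 0) - (if t = e j then 1 else 0))"
  have finF: "finite F" unfolding F by simp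
  have "det ?L = (\<Sum>p\<in>{p. p permutes {0..<n}}. signof p * (\<Prod>i = 0..<n. ?L $$ (i, p i)))"
    by (rule det_def') simp
  also have "\<dots> = (\<Sum>p\<in>{p. p permutes {0..<n}}. signof p * (\<Sum>f\<in>PiE F nb. \<Prod>i = 0..<n. ?D f $$ (i, p i)))"
  proof (rule sum.cong[OF refl])
    fix p assume "p \<in> {p. p permutes {0..<n}}"
    then have p: "p permutes {0..<n}" by simp
    have pn: "p i < n" if "i < n" for i using permutes_in_image[OF p, of i] that by simp
    have "(\<Prod>i = 0..<n. ?L $$ (i, p i)) = (\<Prod>i = 0..<n. \<Sum>t\<in>nb (e i). h i (p i) t)"
    proof (rule prod.cong[OF refl])
      fix i assume i: "i \<in> {0..<n}"
      then have "finite (nb (e i))" using fin F by blast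
      then have "(\<Sum>t\<in>nb (e i). h i (p i) t)
          = (if i = p i then of_nat (card (nb (e i))) else 0) - (if e (p i) \<in> nb (e i) then 1 else 0)"
        unfolding h_def sum_subtractf by (simp add: sum.delta)
      then show "?L $$ (i, p i) = (\<Sum>t\<in>nb (e i). h i (p i) t)" using i pn by simp
    qed
    also have "\<dots> = (\<Prod>i = 0..<n. \<Sum>t\<in>nb (e i). h (\<iota> (e i)) (p (\<iota> (e i))) t)"
      by (rule prod.cong) (auto simp: \<iota>)
    also have "\<dots> = (\<Prod>s\<in>F. \<Sum>t\<in>nb s. h (\<iota> s) (p (\<iota> s)) t)"
      by (rule prod.reindex_bij_betw[OF bij])
    also have "\<dots> = (\<Sum>f\<in>PiE F nb. \<Prod>s\<in>F. h (\<iota> s) (p (\<iota> s)) (f s))"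
      by (rule prod_sum_PiE) (use finF fin in auto)
    also have "\<dots> = (\<Sum>f\<in>PiE F nb. \<Prod>i = 0..<n. ?D f $$ (i, p i))"
    proof (rule sum.cong[OF refl])
      fix f
      have "(\<Prod>s\<in>F. h (\<iota> s) (p (\<iota> s)) (f s)) = (\<Prod>i = 0..<n. h (\<iota> (e i)) (p (\<iota> (e i))) (f (e i)))"
        by (rule prod.reindex_bij_betw[OF bij, symmetric])
      also have "\<dots> = (\<Prod>i = 0..<n. ?D f $$ (i, p i))"
        by (rule prod.cong[OF refl]) (use pn in \<open>auto simp: \<iota> h_def map_laplacian_def\<close>)
      finally show "(\<Prod>s\<in>F. h (\<iota> s) (p (\<iota> s)) (f s)) = (\<Prod>i = 0..<n. ?D f $$ (i, p i))" .
    qed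
    finally show "signof p * (\<Prod>i = 0..<n. ?L $$ (i, p i)) =
        signof p * (\<Sum>f\<in>PiE F nb. \<Prod>i = 0..<n. ?D f $$ (i, p i))" by simp
  qed
  also have "\<dots> = (\<Sum>f\<in>PiE F nb. \<Sum>p\<in>{p. p permutes {0..<n}}. signof p * (\<Prod>i = 0..<n. ?D f $$ (i, p i)))"
    unfolding sum_distrib_left by (rule sum.swap)
  also have "\<dots> = (\<Sum>f\<in>PiE F nb. det (?D f))"
    by (intro sum.cong refl det_def'[symmetric]) (simp add: map_laplacian_def)
  also have "\<dots> = (\<Sum>f\<in>PiE F nb. if ranked F f then 1 else 0)"
    using det_map_laplacian_ranked[OF inj] det_map_laplacian_not_ranked[OF inj]
    unfolding F by (intro sum.cong) auto
  also have "\<dots> = of_nat (card {f \<in> PiE F nb. ranked F f})"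
  proof -
    have "finite (PiE F nb)" using finF fin by (intro finite_PiE) auto
    then show ?thesis by (simp add: sum.If_cases Int_def)
  qed
  finally show ?thesis .
qed

lemma trace_mult_comm:
  fixes A B :: "'a :: comm_semiring_0 mat"
  assumes "A \<in> carrier_mat n n" "B \<in> carrier_mat n n"
  shows "(\<Sum>i = 0..<n. (A * B) $$ (i, i)) = (\<Sum>i = 0..<n. (B * A) $$ (i, i))"
proof -
  have "(\<Sum>i = 0..<n. (A * B) $$ (i, i)) = (\<Sum>i = 0..<n. \<Sum>j = 0..<n. A $$ (i, j) * B $$ (j, i))"
    using assms by (intro sum.cong) (auto simp: scalar_prod_def)
  also have "\<dots> = (\<Sum>j = 0..<n. \<Sum>i = 0..<n. A $$ (i, j) * B $$ (j, i))"
    by (rule sum.swap)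
  also have "\<dots> = (\<Sum>i = 0..<n. (B * A) $$ (i, i))"
    using assms by (intro sum.cong) (auto simp: scalar_prod_def mult.commute)
  finally show ?thesis .
qed

lemma upper_triangular_pow:
  fixes T :: "'a :: comm_semiring_1 mat"
  assumes T: "T \<in> carrier_mat n n" and ut: "upper_triangular T"
  shows "upper_triangular (T ^\<^sub>m k) \<and> (\<forall>i<n. (T ^\<^sub>m k) $$ (i, i) = (T $$ (i, i)) ^ k)"
proof (induction k)
  case 0
  then show ?case using T by (auto intro!: upper_triangularI)
next
  case (Suc k)
  have P: "T ^\<^sub>m k \<in> carrier_mat n n" using T by simp
  have e: "(T ^\<^sub>m Suc k) $$ (i, j) = (\<Sum>l = 0..<n. (T ^\<^sub>m k) $$ (i, l) * T $$ (l, j))"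
    if "i < n" "j < n" for i j
    using that T P by (simp add: scalar_prod_def)
  have z1: "(T ^\<^sub>m k) $$ (i, l) = 0" if "l < i" "i < n" for i l
    using Suc that P unfolding upper_triangular_def by auto
  have z2: "T $$ (i, l) = 0" if "l < i" "i < n" for i l
    using ut that T unfolding upper_triangular_def by auto
  show ?case
  proof (intro conjI allI impI upper_triangularI)
    fix i j assume "j < i" "i < dim_row (T ^\<^sub>m Suc k)"
    then have ij: "j < i" "i < n" "j < n" using T by auto
    have "(T ^\<^sub>m k) $$ (i, l) * T $$ (l, j) = 0" if "l \<in> {0..<n}" for l
      using z1[of l i] z2[of j l] ij that by (cases "l < i") auto
    then show "(T ^\<^sub>m Suc k) $$ (i, j) = 0" unfolding e[OF ij(2,3)] by (intro sum.neutral) auto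
  next
    fix i assume i: "i < n"
    have "(\<Sum>l = 0..<n. (T ^\<^sub>m k) $$ (i, l) * T $$ (l, i)) = (\<Sum>l\<in>{i}. (T ^\<^sub>m k) $$ (i, l) * T $$ (l, i))"
    proof (rule sum.mono_neutral_right)
      show "\<forall>l\<in>{0..<n} - {i}. (T ^\<^sub>m k) $$ (i, l) * T $$ (l, i) = 0"
      proof
        fix l assume "l \<in> {0..<n} - {i}"
        then show "(T ^\<^sub>m k) $$ (i, l) * T $$ (l, i) = 0"
          using z1[of l i] z2[of i l] i by (cases "l < i") auto
      qed
    qed (use i in auto)
    then show "(T ^\<^sub>m Suc k) $$ (i, i) = (T $$ (i, i)) ^ Suc k"
      unfolding e[OF i i] using Suc i by (simp add: mult.commute)
  qed
qed

text \<open>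
  Immediate after passing to a similar upper triangular matrix.
\<close>

lemma trace_pow_eigenvalues:
  fixes B :: "complex mat"
  assumes B: "B \<in> carrier_mat n n"
  obtains es where "length es = n" "char_poly B = (\<Prod>a\<leftarrow>es. [:- a, 1:])"
    "\<And>k. (\<Sum>i = 0..<n. (B ^\<^sub>m k) $$ (i, i)) = (\<Sum>a\<leftarrow>es. a ^ k)"
proof -
  obtain as where "char_poly B = (\<Prod>a\<leftarrow>as. [:- a, 1:])"
    using char_poly_factorized[OF B] by blast
  then obtain T where T: "T \<in> carrier_mat n n" "upper_triangular T" and sim: "similar_mat B T"
    using schur_decomposition_exists[OF B] by blast
  obtain P Q where w: "similar_mat_wit B T P Q" using sim unfolding similar_mat_def by blast
  note pq = similar_mat_witD2[OF B w]
  have "char_poly B = (\<Prod>a\<leftarrow>diag_mat T. [:- a, 1:])"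
    using char_poly_similar[OF sim] char_poly_upper_triangular[OF T] by simp
  moreover have "length (diag_mat T) = n" using T by (simp add: diag_mat_def)
  moreover have "(\<Sum>i = 0..<n. (B ^\<^sub>m k) $$ (i, i)) = (\<Sum>a\<leftarrow>diag_mat T. a ^ k)" for k
  proof -
    have Tk: "T ^\<^sub>m k \<in> carrier_mat n n" using T by simp
    have "B ^\<^sub>m k = P * (T ^\<^sub>m k * Q)"
      using similar_mat_wit_pow_id[OF w, of k] pq Tk by (simp add: assoc_mult_mat[of _ n n _ n _ n])
    then have "(\<Sum>i = 0..<n. (B ^\<^sub>m k) $$ (i, i)) = (\<Sum>i = 0..<n. (T ^\<^sub>m k * Q * P) $$ (i, i))"
      by (simp only:, intro trace_mult_comm) (use pq Tk in auto)
    also have "T ^\<^sub>m k * Q * P = T ^\<^sub>m k"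
      using pq Tk by (simp add: assoc_mult_mat[of _ n n _ n _ n])
    also have "(\<Sum>i = 0..<n. (T ^\<^sub>m k) $$ (i, i)) = (\<Sum>i = 0..<n. (T $$ (i, i)) ^ k)"
      using upper_triangular_pow[OF T, of k] by simp
    also have "\<dots> = (\<Sum>a\<leftarrow>diag_mat T. a ^ k)"
      using T by (simp add: diag_mat_def interv_sum_list_conv_sum_set_nat o_def)
    finally show ?thesis .
  qed
  ultimately show thesis by (intro that) auto
qed

text \<open>
  Compare the two sides of the eigenvector equation at a coordinate of largest modulus.
\<close>

lemma eigenvalue_norm_le_one:
  fixes B :: "complex mat"
  assumes B: "B \<in> carrier_mat n n"
    and row: "\<And>i. i < n \<Longrightarrow> (\<Sum>j = 0..<n. norm (B $$ (i, j))) \<le> 1"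
    and cp: "char_poly B = (\<Prod>a\<leftarrow>es. [:- a, 1:])" and a: "a \<in> set es"
  shows "norm a \<le> 1"
proof -
  have "poly (char_poly B) a = 0"
    unfolding cp poly_prod_list using a by (auto simp: prod_list_zero_iff)
  then obtain v where v: "v \<in> carrier_vec n" "v \<noteq> 0\<^sub>v n" "B *\<^sub>v v = a \<cdot>\<^sub>v v"
    using B eigenvalue_root_char_poly[OF B] unfolding eigenvalue_def eigenvector_def by auto
  have "\<exists>i<n. v $ i \<noteq> 0"
  proof (rule ccontr)
    assume "\<not> ?thesis"
    then have "v = 0\<^sub>v n" using v(1) by (intro eq_vecI) auto
    then show False using v(2) by simp
  qed
  then obtain z where z: "z < n" "v $ z \<noteq> 0" by blast
  define m where "m = Max ((\<lambda>i. norm (v $ i)) ` {0..<n})"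
  have "m \<in> (\<lambda>i. norm (v $ i)) ` {0..<n}" unfolding m_def using z by (intro Max_in) auto
  then obtain i where i: "i < n" "m = norm (v $ i)" by auto
  have le: "norm (v $ j) \<le> m" if "j < n" for j unfolding m_def using that by (intro Max_ge) auto
  have mpos: "0 < m" using le[OF z(1)] z(2) by (metis less_le_trans zero_less_norm_iff)
  have "norm a * m = norm ((a \<cdot>\<^sub>v v) $ i)" using i v(1) by (simp add: norm_mult)
  also have "\<dots> = norm (\<Sum>j = 0..<n. B $$ (i, j) * v $ j)"
    unfolding v(3)[symmetric] using i B v(1) by (simp add: scalar_prod_def)
  also have "\<dots> \<le> (\<Sum>j = 0..<n. norm (B $$ (i, j)) * m)"
    by (intro sum_norm_le) (auto simp: norm_mult intro!: mult_left_mono le)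
  also have "\<dots> = (\<Sum>j = 0..<n. norm (B $$ (i, j))) * m" by (simp add: sum_distrib_right)
  also have "\<dots> \<le> 1 * m" using row[OF i(1)] mpos by (intro mult_right_mono) auto
  finally show ?thesis using mpos by simp
qed

section \<open>Closed walks and the lower bound\<close>

fun walk1 :: "nat \<Rightarrow> int \<Rightarrow> real" where
  "walk1 0 u = (if u = 0 then 1 else 0)"
| "walk1 (Suc k) u = walk1 k (u - 1) + walk1 k (u + 1)"

text \<open>
  The number of walks of length \<open>k\<close> in the square lattice with displacement \<open>s\<close>. Along each step both
  the sum and the difference of the coordinates change by \<open>1\<close> or \<open>-1\<close>, independently of each other, so the
  count is a product of two one-dimensional ones.
\<close>

definition walk2 :: "nat \<Rightarrow> int \<times> int \<Rightarrow> real" where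
  "walk2 k s = walk1 k (fst s + snd s) * walk1 k (fst s - snd s)"

lemma walk1_nonneg: "0 \<le> walk1 k u"
  by (induction k arbitrary: u) auto

lemma walk1_below: "u < - int k \<Longrightarrow> walk1 k u = 0"
  by (induction k arbitrary: u) auto

lemma walk1_binomial: "walk1 k (2 * int j - int k) = real (k choose j)"
proof (induction k arbitrary: j)
  case (Suc k)
  show ?case
  proof (cases j)
    case 0
    have "walk1 k (- int k - 2) = 0" by (rule walk1_below) simp
    then show ?thesis using Suc[of 0] 0 by (simp add: algebra_simps)
  next
    case (Suc i)
    then have "2 * int j - int (Suc k) - 1 = 2 * int i - int k"
      and "2 * int j - int (Suc k) + 1 = 2 * int j - int k" by auto
    then show ?thesis
      unfolding walk1.simps by (simp only: Suc.IH) (simp add: \<open>j = Suc i\<close>)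
  qed
qed auto

lemma walk1_odd: "odd (u + int k) \<Longrightarrow> walk1 k u = 0"
  by (induction k arbitrary: u) auto

lemma walk2_nonneg: "0 \<le> walk2 k s"
  by (simp add: walk2_def walk1_nonneg)

lemma walk2_Suc: "walk2 (Suc k) s = (\<Sum>t\<in>nbrs s. walk2 k t)"
proof -
  obtain x y where s: "s = (x, y)" by force
  have "x + y + 1 = y + (x + 1)" "x + y - 1 = y + (x - 1)" by auto
  then show ?thesis unfolding s by (simp add: walk2_def algebra_simps)
qed

lemma walk2_diff_Suc: "(\<Sum>t\<in>nbrs s. walk2 k (t - r)) = walk2 (Suc k) (s - r)"
proof -
  have "inj_on (\<lambda>t. t - r) (nbrs s)" by (auto simp: inj_on_def)
  moreover have "(\<lambda>t. t - r) ` nbrs s = nbrs (s - r)"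
    by (cases s; cases r) (simp add: algebra_simps)
  ultimately show ?thesis unfolding walk2_Suc by (metis (no_types, lifting) sum.reindex_cong)
qed

lemma walk2_even: "walk2 (2 * m) (0, 0) / 4 ^ (2 * m) = (return_prob m)\<^sup>2"
  using walk1_binomial[of "2 * m" m]
  by (simp add: walk2_def return_prob_def power_mult power2_eq_square power_mult_distrib[symmetric])

lemma walk2_odd: "odd k \<Longrightarrow> walk2 k (0, 0) = 0"
  by (simp add: walk2_def walk1_odd)

lemma walk_series_bound:
  "(\<Sum>k=1..M. walk2 k (0, 0) / 4 ^ k / real k) \<le> 2 * ln 2 - 4 * catalan_const / pi"
proof -
  let ?g = "\<lambda>k. walk2 k (0, 0) / 4 ^ k / real k"
  have "(\<Sum>k=1..M. ?g k) \<le> (\<Sum>k=1..2*M. ?g k)"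
    by (rule sum_mono2) (auto simp: walk2_nonneg)
  also have "\<dots> = (\<Sum>k\<in>(\<lambda>m. 2 * m) ` {1..M}. ?g k)"
  proof (rule sum.mono_neutral_right)
    show "\<forall>k\<in>{1..2*M} - (\<lambda>m. 2 * m) ` {1..M}. ?g k = 0"
    proof
      fix k assume k: "k \<in> {1..2*M} - (\<lambda>m. 2 * m) ` {1..M}"
      have "odd k"
      proof
        assume "even k"
        then obtain m where "k = 2 * m" by blast
        then show False using k by auto
      qed
      then show "?g k = 0" by (simp add: walk2_odd)
    qed
  qed auto
  also have "\<dots> = (\<Sum>m=1..M. ?g (2 * m))"
    by (subst sum.reindex) (auto simp: inj_on_def)
  also have "\<dots> = (\<Sum>m=1..M. (return_prob m)\<^sup>2 / (2 * real m))"
    by (simp add: walk2_even)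
  also have "\<dots> \<le> 2 * ln 2 - 4 * catalan_const / pi" by (rule return_series_bound)
  finally show ?thesis .
qed

text \<open>
  The hypotheses on \<open>t\<close> say that the power sums of \<open>es\<close> are nonnegative reals. For \<open>0 < r < 1\<close> the
  logarithm of the modulus of the product of the factors \<open>1 - r * a\<close> is minus the sum of \<open>r ^ k * t k / k\<close>, which is at
  least \<open>- S\<close>. As some \<open>a\<close> may have norm \<open>1\<close>, where the logarithmic series need not converge, the value
  \<open>r = 1\<close> is reached by continuity of the product.
\<close>

lemma prod_one_minus_bound:
  fixes es :: "complex list"
  assumes nrm: "\<And>a. a \<in> set es \<Longrightarrow> norm a \<le> 1"
    and t: "\<And>k. (\<Sum>a\<leftarrow>es. a ^ k) = complex_of_real (t k)" and tnn: "\<And>k. 0 \<le> t k"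
    and S: "\<And>M. (\<Sum>k=1..M. t k / real k) \<le> S"
  shows "exp (- S) \<le> norm (\<Prod>a\<leftarrow>es. 1 - a)"
proof -
  have main: "exp (- S) \<le> norm (\<Prod>a\<leftarrow>es. 1 - complex_of_real r * a)" if r: "0 < r" "r < 1" for r
  proof -
    have na: "norm (complex_of_real r * a) < 1" if "a \<in> set es" for a
    proof -
      have "norm (complex_of_real r * a) \<le> r * 1"
        using nrm[OF that] r by (simp add: norm_mult)
      then show ?thesis using r by simp
    qed
    have "(\<lambda>n. \<Sum>a\<leftarrow>as. - ((complex_of_real r * a) ^ n) / of_nat n) sums (\<Sum>a\<leftarrow>as. Ln (1 - complex_of_real r * a))"
      if "set as \<subseteq> set es" for as
      using that
    proof (induction as)
      case (Cons a as)
      have "(\<lambda>n. - ((- (- (complex_of_real r * a))) ^ n) / of_nat n) sums Ln (1 + (- (complex_of_real r * a)))"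
        by (rule Ln_series') (use na Cons.prems in auto)
      then have "(\<lambda>n. - ((complex_of_real r * a) ^ n) / of_nat n) sums Ln (1 - complex_of_real r * a)"
        by simp
      from sums_add[OF this Cons.IH] show ?case using Cons.prems by simp
    qed simp
    from sums_Re[OF this[OF order_refl]]
    have "(\<lambda>n. Re (\<Sum>a\<leftarrow>es. - ((complex_of_real r * a) ^ n) / of_nat n)) sums Re (\<Sum>a\<leftarrow>es. Ln (1 - complex_of_real r * a))" .
    moreover have "(\<Sum>a\<leftarrow>es. - ((complex_of_real r * a) ^ n) / of_nat n) = complex_of_real (- (r ^ n / real n * t n))" for n
    proof -
      have "(\<Sum>a\<leftarrow>es. - ((complex_of_real r * a) ^ n) / of_nat n) = - (of_real (r ^ n / real n)) * (\<Sum>a\<leftarrow>es. a ^ n)"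
        unfolding sum_list_const_mult[symmetric]
        by (intro arg_cong[of _ _ sum_list] map_cong) (auto simp: power_mult_distrib)
      then show ?thesis unfolding t by simp
    qed
    ultimately have "(\<lambda>n. - (r ^ n / real n * t n)) sums Re (\<Sum>a\<leftarrow>es. Ln (1 - complex_of_real r * a))"
      by simp
    from sums_minus[OF this]
    have sm: "(\<lambda>n. r ^ n / real n * t n) sums (- Re (\<Sum>a\<leftarrow>es. Ln (1 - complex_of_real r * a)))" by simp
    have "suminf (\<lambda>n. r ^ n / real n * t n) \<le> S"
    proof (rule suminf_le_const)
      show "summable (\<lambda>n. r ^ n / real n * t n)" using sm by (rule sums_summable)
      fix n
      have "(\<Sum>i<n. r ^ i / real i * t i) \<le> (\<Sum>i<n. t i / real i)"
      proof (rule sum_mono)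
        fix i
        have "r ^ i * (t i / real i) \<le> 1 * (t i / real i)"
          using r tnn[of i] by (intro mult_right_mono) (auto simp: power_le_one)
        then show "r ^ i / real i * t i \<le> t i / real i" by simp
      qed
      also have "\<dots> \<le> (\<Sum>i\<in>insert 0 {1..n}. t i / real i)"
        using tnn by (intro sum_mono2) auto
      also have "\<dots> \<le> S" using S[of n] by simp
      finally show "(\<Sum>i<n. r ^ i / real i * t i) \<le> S" .
    qed
    then have "- S \<le> Re (\<Sum>a\<leftarrow>es. Ln (1 - complex_of_real r * a))"
      using sm by (simp add: sums_iff)
    moreover have "exp (\<Sum>a\<leftarrow>as. Ln (1 - complex_of_real r * a)) = (\<Prod>a\<leftarrow>as. 1 - complex_of_real r * a)"
      if "set as \<subseteq> set es" for as
      using that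
    proof (induction as)
      case (Cons a as)
      have "complex_of_real r * a \<noteq> 1" using na[of a] Cons.prems by auto
      then show ?case using Cons by (simp add: exp_add)
    qed simp
    ultimately show ?thesis by (metis exp_le_cancel_iff norm_exp_eq_Re order_refl)
  qed
  have "isCont (\<lambda>r. norm (\<Prod>a\<leftarrow>as. 1 - complex_of_real r * a)) 1" for as
    by (induction as) (auto intro!: continuous_intros simp: norm_mult)
  moreover have "(\<lambda>k. 1 - 1 / (real k + 2)) \<longlonglongrightarrow> 1" by real_asymp
  ultimately have "(\<lambda>k. norm (\<Prod>a\<leftarrow>es. 1 - complex_of_real (1 - 1 / (real k + 2)) * a)) \<longlonglongrightarrow>
      norm (\<Prod>a\<leftarrow>es. 1 - complex_of_real 1 * a)"
    by (rule isCont_tendsto_compose)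
  then have "exp (- S) \<le> norm (\<Prod>a\<leftarrow>es. 1 - complex_of_real 1 * a)"
  proof (rule LIMSEQ_le_const)
    have "exp (- S) \<le> norm (\<Prod>a\<leftarrow>es. 1 - complex_of_real (1 - 1 / (real k + 2)) * a)" for k
      by (rule main) (simp_all add: divide_simps)
    then show "\<exists>N. \<forall>k\<ge>N. exp (- S) \<le> norm (\<Prod>a\<leftarrow>es. 1 - complex_of_real (1 - 1 / (real k + 2)) * a)"
      by blast
  qed
  then show ?thesis by simp
qed

text \<open>
  For \<open>B = A / 4\<close>, with \<open>A\<close> the adjacency matrix of \<open>F\<close>, the count is \<open>4 ^ n * det (1 - B)\<close>, and
  \<open>det (1 - B)\<close> is estimated through the traces of the powers of \<open>B\<close>. The entries of \<open>A ^ k\<close> count walks that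
  stay in \<open>F\<close>; forgetting this constraint bounds them by \<open>walk2\<close>.
\<close>

lemma card_ranked_lower:
  assumes "finite F"
  shows "\<bb> ^ card F \<le> real (card {f \<in> PiE F nbrs. ranked F f})"
proof -
  define n where "n = card F"
  obtain e where bij: "bij_betw e {0..<n} F"
    using ex_bij_betw_nat_finite[OF assms] unfolding n_def by blast
  have inj: "inj_on e {0..<n}" and F: "F = e ` {0..<n}" using bij by (auto simp: bij_betw_def)
  define B :: "complex mat" where "B = mat n n (\<lambda>(i, j). if e j \<in> nbrs (e i) then 1 / 4 else 0)"
  have B: "B \<in> carrier_mat n n" by (simp add: B_def)
  have filt: "(\<Sum>j = 0..<n. if e j \<in> nbrs s then g (e j) else 0) = sum g (nbrs s \<inter> F)" for s and g :: "_ \<Rightarrow> real"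
  proof -
    have "(\<Sum>j = 0..<n. if e j \<in> nbrs s then g (e j) else 0) = (\<Sum>u\<in>F. if u \<in> nbrs s then g u else 0)"
      by (rule sum.reindex_bij_betw[OF bij])
    also have "\<dots> = sum g (nbrs s \<inter> F)"
      using assms by (simp add: sum.If_cases Int_commute)
    finally show ?thesis .
  qed
  have filt_le: "(\<Sum>j = 0..<n. if e j \<in> nbrs s then g (e j) else 0) \<le> sum g (nbrs s)"
    if "\<And>u. 0 \<le> g u" for s and g :: "_ \<Rightarrow> real"
    unfolding filt by (rule sum_mono2) (use that in auto)
  have row: "(\<Sum>j = 0..<n. norm (B $$ (i, j))) \<le> 1" if "i < n" for i
  proof -
    have "(\<Sum>j = 0..<n. norm (B $$ (i, j))) = (\<Sum>j = 0..<n. if e j \<in> nbrs (e i) then 1 / 4 else 0)"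
      using that by (intro sum.cong) (auto simp: B_def)
    also have "\<dots> \<le> (\<Sum>u\<in>nbrs (e i). 1 / 4)" by (rule filt_le) simp
    finally show ?thesis by simp
  qed
  obtain es where es: "length es = n" "char_poly B = (\<Prod>a\<leftarrow>es. [:- a, 1:])"
    and tr: "\<And>k. (\<Sum>i = 0..<n. (B ^\<^sub>m k) $$ (i, i)) = (\<Sum>a\<leftarrow>es. a ^ k)"
    using trace_pow_eigenvalues[OF B] by blast
  \<comment> \<open>The entries of the powers of \<open>B\<close> are nonnegative reals, bounded by unrestricted walks.\<close>
  have "\<exists>q. \<forall>i<n. \<forall>j<n. (B ^\<^sub>m k) $$ (i, j) = complex_of_real (q i j) \<and>
      0 \<le> q i j \<and> q i j \<le> walk2 k (e j - e i) / 4 ^ k" for k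
  proof (induction k)
    case 0
    have "walk2 0 (e i - e i) = 1" for i by (simp add: walk2_def)
    then show ?case using B
      by (intro exI[of _ "\<lambda>i j. if i = j then 1 else 0"]) (auto simp: walk2_nonneg)
  next
    case (Suc k)
    then obtain q where q: "\<And>i j. i < n \<Longrightarrow> j < n \<Longrightarrow> (B ^\<^sub>m k) $$ (i, j) = complex_of_real (q i j)"
      "\<And>i j. i < n \<Longrightarrow> j < n \<Longrightarrow> 0 \<le> q i j"
      "\<And>i j. i < n \<Longrightarrow> j < n \<Longrightarrow> q i j \<le> walk2 k (e j - e i) / 4 ^ k" by blast
    define q' where "q' = (\<lambda>i j. \<Sum>l = 0..<n. if e l \<in> nbrs (e j) then q i l / 4 else 0)"
    show ?case
    proof (intro exI[of _ q'] allI impI conjI)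
      fix i j assume ij: "i < n" "j < n"
      have "(B ^\<^sub>m Suc k) $$ (i, j) = (\<Sum>l = 0..<n. (B ^\<^sub>m k) $$ (i, l) * B $$ (l, j))"
        using ij B by (simp add: scalar_prod_def)
      also have "\<dots> = (\<Sum>l = 0..<n. complex_of_real (if e l \<in> nbrs (e j) then q i l / 4 else 0))"
        using ij q(1)[of i] by (intro sum.cong) (auto simp: B_def nbrs_sym[of "e j"])
      finally show "(B ^\<^sub>m Suc k) $$ (i, j) = complex_of_real (q' i j)" by (simp add: q'_def)
      show "0 \<le> q' i j" unfolding q'_def using ij q(2) by (intro sum_nonneg) auto
      have "q' i j \<le> (\<Sum>l = 0..<n. if e l \<in> nbrs (e j) then walk2 k (e l - e i) / 4 ^ Suc k else 0)"
        unfolding q'_def using ij q(3)[of i] by (intro sum_mono) (auto simp: field_simps)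
      also have "\<dots> \<le> (\<Sum>t\<in>nbrs (e j). walk2 k (t - e i) / 4 ^ Suc k)"
        by (rule filt_le) (simp add: walk2_nonneg)
      also have "\<dots> = walk2 (Suc k) (e j - e i) / 4 ^ Suc k"
        unfolding sum_divide_distrib[symmetric] walk2_diff_Suc ..
      finally show "q' i j \<le> walk2 (Suc k) (e j - e i) / 4 ^ Suc k" .
    qed
  qed
  then obtain q where q: "\<And>k i j. i < n \<Longrightarrow> j < n \<Longrightarrow> (B ^\<^sub>m k) $$ (i, j) = complex_of_real (q k i j)"
    "\<And>k i j. i < n \<Longrightarrow> j < n \<Longrightarrow> 0 \<le> q k i j"
    "\<And>k i j. i < n \<Longrightarrow> j < n \<Longrightarrow> q k i j \<le> walk2 k (e j - e i) / 4 ^ k" by metis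
  define t where "t = (\<lambda>k. \<Sum>i = 0..<n. q k i i)"
  have t: "(\<Sum>a\<leftarrow>es. a ^ k) = complex_of_real (t k)" for k
    unfolding tr[symmetric] t_def by (simp add: q(1))
  have tnn: "0 \<le> t k" for k unfolding t_def by (intro sum_nonneg) (simp add: q(2))
  have tle: "t k \<le> real n * (walk2 k (0, 0) / 4 ^ k)" for k
  proof -
    have z: "(0 :: int \<times> int) = (0, 0)" by (simp add: zero_prod_def)
    have "t k \<le> (\<Sum>i = 0..<n. walk2 k (e i - e i) / 4 ^ k)"
      unfolding t_def by (intro sum_mono q(3)) auto
    then show ?thesis by (simp add: z)
  qed
  define S where "S = real n * (2 * ln 2 - 4 * catalan_const / pi)"
  have S: "(\<Sum>k=1..M. t k / real k) \<le> S" for M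
  proof -
    have "(\<Sum>k=1..M. t k / real k) \<le> (\<Sum>k=1..M. real n * (walk2 k (0, 0) / 4 ^ k / real k))"
    proof (rule sum_mono)
      fix k
      have "t k / real k \<le> real n * (walk2 k (0, 0) / 4 ^ k) / real k"
        by (rule divide_right_mono[OF tle]) simp
      then show "t k / real k \<le> real n * (walk2 k (0, 0) / 4 ^ k / real k)" by simp
    qed
    also have "\<dots> \<le> S"
      unfolding S_def sum_distrib_left[symmetric] by (intro mult_left_mono walk_series_bound) simp
    finally show ?thesis .
  qed
  have "exp (- S) \<le> norm (\<Prod>a\<leftarrow>es. 1 - a)"
    using eigenvalue_norm_le_one[OF B row es(2)] t tnn S by (rule prod_one_minus_bound)
  also have "(\<Prod>a\<leftarrow>es. 1 - a) = poly (char_poly B) 1"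
    unfolding es(2) poly_prod_list by (simp add: o_def)
  also have "\<dots> = det (- char_matrix B 1)" by (rule char_poly_matrix[OF B])
  finally have 1: "exp (- S) \<le> norm (det (- char_matrix B 1))" .
  have "of_nat (card {f \<in> PiE F nbrs. ranked F f}) = det (mat n n (\<lambda>(i, j). (if i = j then of_nat (card (nbrs (e i))) else 0) -
            (if e j \<in> nbrs (e i) then 1 else (0 :: complex))))"
    by (rule rooted_matrix_tree[OF bij, symmetric]) simp
  also have "mat n n (\<lambda>(i, j). (if i = j then of_nat (card (nbrs (e i))) else 0) -
            (if e j \<in> nbrs (e i) then 1 else (0 :: complex))) = 4 \<cdot>\<^sub>m (- char_matrix B 1)"
    by (rule eq_matI) (auto simp: char_matrix_def B_def)
  also have "det \<dots> = 4 ^ n * det (- char_matrix B 1)"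
    using B by (simp add: char_matrix_def)
  finally have "(of_nat (card {f \<in> PiE F nbrs. ranked F f}) :: complex) = 4 ^ n * det (- char_matrix B 1)" .
  from arg_cong[OF this, of norm]
  have "real (card {f \<in> PiE F nbrs. ranked F f}) = 4 ^ n * norm (det (- char_matrix B 1))"
    by (simp only: norm_mult norm_of_nat norm_power norm_numeral)
  moreover have "\<bb> ^ n = 4 ^ n * exp (- S)"
  proof -
    have "(4 :: real) ^ n = exp (2 * ln 2) ^ n" by (simp add: exp_double)
    also have "\<dots> = exp (real n * (2 * ln 2))" by (rule exp_of_nat_mult[symmetric])
    finally show ?thesis
      by (simp add: \<bb>_def exp_of_nat_mult[symmetric] S_def exp_add[symmetric] algebra_simps)
  qed
  ultimately show ?thesis using 1 by (simp add: n_def)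
qed

lemma card_ranked_upper:
  assumes "finite F"
  shows "card {f \<in> PiE F nbrs. ranked F f} \<le> 4 ^ card F"
proof -
  have "card {f \<in> PiE F nbrs. ranked F f} \<le> card (PiE F nbrs)"
    by (rule card_mono) (use assms in \<open>auto intro!: finite_PiE\<close>)
  also have "\<dots> = 4 ^ card F" using assms by (simp add: card_PiE)
  finally show ?thesis .
qed

section \<open>Trees and cycles in finite graphs\<close>

abbreviation adj :: "'a set set \<Rightarrow> ('a \<times> 'a) set" where
  "adj E \<equiv> {(x, y). {x, y} \<in> E}"

lemma adj_rtrancl_sym: "(u, v) \<in> (adj E)\<^sup>* \<Longrightarrow> (v, u) \<in> (adj E)\<^sup>*"
  using sym_rtrancl[of "adj E"] by (auto simp: sym_def insert_commute dest: symD)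

lemma cycle_in_mono: "cycle_in E p \<Longrightarrow> E \<subseteq> E' \<Longrightarrow> cycle_in E' p"
  unfolding cycle_in_def by blast

lemma rtrancl_distinct_path:
  assumes "(u, v) \<in> (adj E)\<^sup>*"
  shows "\<exists>p. p \<noteq> [] \<and> hd p = u \<and> last p = v \<and> distinct p \<and> successively (\<lambda>x y. {x, y} \<in> E) p"
  using assms
proof (induction rule: rtrancl_induct)
  case base
  show ?case by (rule exI[of _ "[u]"]) simp
next
  case (step y z)
  then obtain p where p: "p \<noteq> []" "hd p = u" "last p = y" "distinct p"
    "successively (\<lambda>x y. {x, y} \<in> E) p" by blast
  show ?case
  proof (cases "z \<in> set p")
    case True
    then obtain ps qs where pq: "p = ps @ z # qs" by (meson split_list)
    show ?thesis
      by (rule exI[of _ "ps @ [z]"])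
         (use p in \<open>auto simp: pq successively_append_iff hd_append split: if_splits\<close>)
  next
    case False
    show ?thesis
      by (rule exI[of _ "p @ [z]"])
         (use p step(2) False in \<open>auto simp: successively_append_iff\<close>)
  qed
qed

lemma cycle_inI:
  assumes "length p > 2" "distinct p" "successively (\<lambda>x y. {x, y} \<in> E) p" "{last p, hd p} \<in> E"
  shows "cycle_in E p"
  unfolding cycle_in_def
proof (intro conjI allI impI)
  fix i assume i: "i < length p"
  show "{p ! i, p ! (Suc i mod length p)} \<in> E"
  proof (cases "Suc i < length p")
    case True
    then show ?thesis using assms(3) by (simp add: successively_conv_nth)
  next
    case False
    then have "i = length p - 1" "Suc i = length p" using i by simp_all
    then have "p ! i = last p" "p ! (Suc i mod length p) = hd p"
      using assms(1) by (auto simp: last_conv_nth hd_conv_nth simp flip: length_greater_0_conv)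
    then show ?thesis using assms(4) by simp
  qed
qed (use assms in auto)

text \<open>
  Otherwise the edge would close a path of the subgraph to a cycle.
\<close>

lemma acyclic_edge_in_connected_subgraph:
  assumes acyc: "\<nexists>p. cycle_in E p" and sub: "E' \<subseteq> E"
    and e: "{u, v} \<in> E" "u \<noteq> v" and con: "(u, v) \<in> (adj E')\<^sup>*"
  shows "{u, v} \<in> E'"
proof (rule ccontr)
  assume n: "{u, v} \<notin> E'"
  obtain p where p: "p \<noteq> []" "hd p = u" "last p = v" "distinct p"
    "successively (\<lambda>x y. {x, y} \<in> E') p" using rtrancl_distinct_path[OF con] by blast
  have len: "length p > 2"
  proof (rule ccontr)
    assume l: "\<not> length p > 2"
    obtain a q where pa: "p = a # q" using p(1) by (cases p) auto
    obtain b q' where q: "q = b # q'" using pa p(2,3) e(2) by (cases q) auto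
    then have "q' = []" using l pa by (cases q') auto
    then show False using pa q p n by simp
  qed
  have "successively (\<lambda>x y. {x, y} \<in> E) p"
    using p(5) sub by (auto simp: successively_conv_nth)
  then have "cycle_in E p"
    using p len e(1) by (intro cycle_inI) (auto simp: insert_commute)
  then show False using acyc by blast
qed

text \<open>
  The rank is the distance to the complement of \<open>F\<close>, and \<open>f\<close> is a first step of a shortest path.
\<close>

lemma ex_rank_towards_exit:
  assumes "\<And>s. s \<in> F \<Longrightarrow> \<exists>t. t \<notin> F \<and> (s, t) \<in> R\<^sup>*"
  shows "\<exists>f (d :: 'a \<Rightarrow> nat). \<forall>s\<in>F. (s, f s) \<in> R \<and> d (f s) < d s"
proof -
  define d where "d = (\<lambda>s. LEAST k. \<exists>t. t \<notin> F \<and> (s, t) \<in> R ^^ k)"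
  have "\<exists>u. (s, u) \<in> R \<and> d u < d s" if s: "s \<in> F" for s
  proof -
    have "\<exists>k. \<exists>t. t \<notin> F \<and> (s, t) \<in> R ^^ k"
      using assms[OF s] by (meson rtrancl_imp_relpow)
    then have "\<exists>t. t \<notin> F \<and> (s, t) \<in> R ^^ d s" unfolding d_def by (rule LeastI_ex)
    then obtain t where t: "t \<notin> F" "(s, t) \<in> R ^^ d s" by blast
    then obtain k where k: "d s = Suc k" using s by (cases "d s") auto
    obtain u where u: "(s, u) \<in> R" "(u, t) \<in> R ^^ k" using t(2) unfolding k by (meson relpow_Suc_D2)
    have "d u \<le> k" unfolding d_def by (rule Least_le) (use t u in blast)
    then show ?thesis using u k by auto
  qed
  then obtain f where "\<forall>s\<in>F. (s, f s) \<in> R \<and> d (f s) < d s" by metis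
  then show ?thesis by blast
qed

text \<open>
  The first vertex of a longest path has a second neighbour, and by maximality that neighbour lies on
  the path.
\<close>

lemma min_degree_two_cycle:
  assumes fin: "finite B" and ne: "B \<noteq> {}"
    and edge: "\<And>e. e \<in> B \<Longrightarrow> \<exists>u v. u \<noteq> v \<and> e = {u, v}"
    and deg: "\<And>e v. e \<in> B \<Longrightarrow> v \<in> e \<Longrightarrow> \<exists>e'\<in>B. e' \<noteq> e \<and> v \<in> e'"
  shows "\<exists>p. cycle_in B p"
proof -
  define P where "P = (\<lambda>p. length p \<ge> 2 \<and> distinct p \<and> successively (\<lambda>x y. {x, y} \<in> B) p)"
  have finU: "finite (\<Union>B)"
  proof (rule finite_Union[OF fin])
    fix e assume "e \<in> B"
    then obtain u v where "e = {u, v}" using edge by blast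
    then show "finite e" by simp
  qed
  have bound: "length p \<le> card (\<Union>B)" if Pp: "P p" for p
  proof -
    have "set p \<subseteq> \<Union>B"
    proof
      fix x assume "x \<in> set p"
      then obtain i where i: "i < length p" "p ! i = x" by (meson in_set_conv_nth)
      have s: "\<And>j. Suc j < length p \<Longrightarrow> {p ! j, p ! Suc j} \<in> B"
        using that by (simp add: P_def successively_conv_nth)
      show "x \<in> \<Union>B"
      proof (cases "Suc i < length p")
        case True
        then show ?thesis using s[of i] i by blast
      next
        case False
        then obtain j where "i = Suc j" using Pp i by (cases i) (auto simp: P_def)
        then show ?thesis using s[of j] i by blast
      qed
    qed
    then have "card (set p) \<le> card (\<Union>B)" by (rule card_mono[OF finU])
    then show ?thesis using that by (simp add: P_def distinct_card)
  qed
  obtain e where "e \<in> B" using ne by blast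
  moreover from edge[OF this] obtain u v where "u \<noteq> v" "e = {u, v}" by blast
  ultimately have uv: "u \<noteq> v" "{u, v} \<in> B" by auto
  then have "P [u, v]" by (simp add: P_def)
  then obtain p where p: "P p" and max: "\<And>q. P q \<Longrightarrow> length q \<le> length p"
    using ex_has_greatest_nat[of P "[u, v]" length "card (\<Union>B) + 1"] bound by (metis less_Suc_eq_le Suc_eq_plus1)
  obtain a b r where abr: "p = a # b # r"
    using p by (cases p rule: remdups_adj.cases) (auto simp: P_def)
  have ab: "{a, b} \<in> B" using p by (simp add: P_def abr)
  obtain e' where e': "e' \<in> B" "e' \<noteq> {a, b}" "a \<in> e'" using deg[OF ab, of a] by blast
  obtain z where z: "e' = {a, z}" "z \<noteq> a" using edge[OF e'(1)] e'(3) by blast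
  have zb: "z \<noteq> b" using z e' by blast
  have "z \<in> set p"
  proof (rule ccontr)
    assume "z \<notin> set p"
    then have "P (z # p)" using p z e'(1) by (simp add: P_def abr insert_commute)
    then show False using max by fastforce
  qed
  then have "z \<in> set r" using z zb by (auto simp: abr)
  then obtain r1 r2 where r: "r = r1 @ z # r2" by (meson split_list)
  have "successively (\<lambda>x y. {x, y} \<in> B) ((a # b # r1 @ [z]) @ r2)" using p by (simp add: P_def abr r)
  then have "successively (\<lambda>x y. {x, y} \<in> B) (a # b # r1 @ [z])"
    by (simp only: successively_append_iff)
  then have "cycle_in B (a # b # r1 @ [z])"
    using p z e'(1) by (intro cycle_inI) (auto simp: P_def abr r insert_commute)
  then show ?thesis ..
qed

text \<open>
  Mapping every vertex other than a root to the first edge of a shortest path to the root is a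
  bijection onto the edges of the tree.
\<close>

lemma tree_card:
  assumes tree: "ugraph_tree \<lparr>uverts = V, uedges = T\<rparr>" and finV: "finite V" and sub: "\<Union>T \<subseteq> V"
    and edge: "\<And>e. e \<in> T \<Longrightarrow> \<exists>u v. u \<noteq> v \<and> e = {u, v}"
  shows "card T + 1 = card V"
proof -
  have con: "\<And>u v. u \<in> V \<Longrightarrow> v \<in> V \<Longrightarrow> (u, v) \<in> (adj T)\<^sup>*" and ne: "V \<noteq> {}"
    and acyc: "\<nexists>p. cycle_in T p"
    using tree by (auto simp: ugraph_tree_def ugraph_connected_def)
  obtain r where r: "r \<in> V" using ne by blast
  let ?F = "V - {r}"
  have "\<exists>t. t \<notin> ?F \<and> (s, t) \<in> (adj T)\<^sup>*" if "s \<in> ?F" for s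
    using con[of s r] r that by blast
  then obtain f and d :: "'a \<Rightarrow> nat" where "\<forall>s\<in>?F. (s, f s) \<in> adj T \<and> d (f s) < d s"
    using ex_rank_towards_exit[of ?F "adj T"] by blast
  then have f: "\<And>s. s \<in> ?F \<Longrightarrow> (s, f s) \<in> adj T" and d: "\<And>s. s \<in> ?F \<Longrightarrow> d (f s) < d s" by blast+
  define E' where "E' = (\<lambda>s. {s, f s}) ` ?F"
  have E'T: "E' \<subseteq> T" using f unfolding E'_def by auto
  have fV: "f s \<in> V" if "s \<in> ?F" for s using f[OF that] sub by blast
  have root: "(s, r) \<in> (adj E')\<^sup>*" if "s \<in> V" for s
    using that
  proof (induction "d s" arbitrary: s rule: less_induct)
    case less
    show ?case
    proof (cases "s = r")
      case False
      then have s: "s \<in> ?F" using less by simp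
      then have "(s, f s) \<in> adj E'" unfolding E'_def by auto
      then show ?thesis using less.hyps[OF d[OF s] fV[OF s]] by (rule converse_rtrancl_into_rtrancl)
    qed simp
  qed
  have "T \<subseteq> E'"
  proof
    fix e assume e: "e \<in> T"
    then obtain u v where uv: "u \<noteq> v" "e = {u, v}" using edge by blast
    then have "u \<in> V" "v \<in> V" using e sub by auto
    then have "(u, v) \<in> (adj E')\<^sup>*"
      using rtrancl_trans[OF root adj_rtrancl_sym[OF root]] by simp
    then show "e \<in> E'" using acyclic_edge_in_connected_subgraph[OF acyc E'T] e uv by blast
  qed
  with E'T have "T = E'" by blast
  moreover have "inj_on (\<lambda>s. {s, f s}) ?F"
  proof (rule inj_onI)
    fix s t assume st: "s \<in> ?F" "t \<in> ?F" "{s, f s} = {t, f t}"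
    show "s = t"
    proof (rule ccontr)
      assume "s \<noteq> t"
      then have "s = f t" "t = f s" using st(3) by (auto simp: doubleton_eq_iff)
      then show False using d[OF st(1)] d[OF st(2)] by simp
    qed
  qed
  ultimately have "card T = card ?F" unfolding E'_def by (simp add: card_image)
  then show ?thesis using r finV by (metis card.remove Suc_eq_plus1)
qed

section \<open>Sides of lattice squares\<close>

text \<open>
  A square is represented by its lower left corner. For neighbouring squares, \<open>border\<close> is their common
  side as an edge of the lattice; every lattice edge arises in this way from exactly two ordered pairs.
\<close>

fun corners :: "int \<times> int \<Rightarrow> (int \<times> int) set" where
  "corners (x, y) = {(x, y), (x + 1, y), (x, y + 1), (x + 1, y + 1)}"

definition border :: "int \<times> int \<Rightarrow> int \<times> int \<Rightarrow> (int \<times> int) set" where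
  "border s t = corners s \<inter> corners t"

lemma border_sym: "border s t = border t s"
  by (auto simp: border_def)

lemma border_simps:
  "border (x, y) (x + 1, y) = {(x + 1, y), (x + 1, y + 1)}"
  "border (x, y) (x - 1, y) = {(x, y), (x, y + 1)}"
  "border (x, y) (x, y + 1) = {(x, y + 1), (x + 1, y + 1)}"
  "border (x, y) (x, y - 1) = {(x, y), (x + 1, y)}"
  by (auto simp: border_def)

lemma border_doubleton:
  assumes "t \<in> nbrs s"
  shows "\<exists>u v. u \<noteq> v \<and> border s t = {u, v}"
proof -
  obtain x y where s: "s = (x, y)" by force
  have "card (border s t) = 2" using assms unfolding s by (auto simp: border_simps)
  then show ?thesis by (metis card_2_iff)
qed

lemma border_eq_iff:
  assumes "t \<in> nbrs s" "t' \<in> nbrs s'"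
  shows "border s t = border s' t' \<longleftrightarrow> s' = s \<and> t' = t \<or> s' = t \<and> t' = s"
proof -
  obtain x y x' y' where s: "s = (x, y)" "s' = (x', y')" by force
  show ?thesis
  proof
    assume "border s t = border s' t'"
    then show "s' = s \<and> t' = t \<or> s' = t \<and> t' = s"
      using assms unfolding s by (auto simp: border_simps doubleton_eq_iff)
  qed (auto simp: border_sym)
qed

text \<open>
  Running once around a square enters and leaves the vertex set \<open>X\<close> equally often. The next lemma is
  its dual: running once around a vertex enters and leaves a set \<open>X\<close> of squares equally often.
\<close>

lemma face_second_cut_edge:
  assumes "t \<in> nbrs s" "border s t \<inter> X \<noteq> {}" "\<not> border s t \<subseteq> X"
  shows "\<exists>t'\<in>nbrs s. t' \<noteq> t \<and> border s t' \<inter> X \<noteq> {} \<and> \<not> border s t' \<subseteq> X"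
proof -
  obtain x y where s: "s = (x, y)" by force
  show ?thesis using assms unfolding s by (auto simp: border_simps)
qed

lemma vertex_second_boundary_edge:
  assumes "t \<in> nbrs s" "s \<in> X" "t \<notin> X" "v \<in> border s t"
  shows "\<exists>s'\<in>X. \<exists>t'\<in>nbrs s'. t' \<notin> X \<and> v \<in> border s' t' \<and> border s' t' \<noteq> border s t"
proof -
  obtain a b where v: "v = (a, b)" by force
  define q0 q1 q2 q3 where q: "q0 = (a, b)" "q1 = (a - 1, b)" "q2 = (a - 1, b - 1)" "q3 = (a, b - 1)"
  have st: "(s, t) \<in> {(q0, q1), (q1, q2), (q2, q3), (q3, q0), (q1, q0), (q2, q1), (q3, q2), (q0, q3)}"
  proof -
    obtain x y where s: "s = (x, y)" by force
    have "t = (x + 1, y) \<and> a = x + 1 \<and> (b = y \<or> b = y + 1) \<or> t = (x - 1, y) \<and> a = x \<and> (b = y \<or> b = y + 1)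
        \<or> t = (x, y + 1) \<and> b = y + 1 \<and> (a = x \<or> a = x + 1) \<or> t = (x, y - 1) \<and> b = y \<and> (a = x \<or> a = x + 1)"
      using assms(1,4) unfolding s v nbrs.simps insert_iff empty_iff
      by (elim disjE) (simp_all add: border_simps, auto)
    then show ?thesis unfolding s by (elim disjE conjE) (simp_all add: q)
  qed
  have diff: "border s' t' \<noteq> border s t" if "t' \<in> nbrs s'" "{s', t'} \<noteq> {s, t}" for s' t'
    using border_eq_iff[OF assms(1) that(1)] that(2) by (auto simp: insert_commute)
  \<comment> \<open>Turn around \<open>v\<close> from \<open>t\<close> back to \<open>s\<close> and stop when \<open>X\<close> is entered again.\<close>
  have turn: ?thesis
    if "s = p0" "t = p1" "distinct [p0, p1, p2, p3]" "p1 \<in> nbrs p2" "p2 \<in> nbrs p3" "p3 \<in> nbrs p0"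
      "v \<in> border p2 p1" "v \<in> border p3 p2" "v \<in> border p0 p3" for p0 p1 p2 p3
  proof -
    consider "p2 \<in> X" | "p2 \<notin> X" "p3 \<in> X" | "p3 \<notin> X" by blast
    then show ?thesis
    proof cases
      case 1
      have "border p2 p1 \<noteq> border s t" using that by (intro diff) (auto simp: doubleton_eq_iff)
      then show ?thesis using 1 that assms(3) by blast
    next
      case 2
      have "border p3 p2 \<noteq> border s t" using that by (intro diff) (auto simp: doubleton_eq_iff)
      then show ?thesis using 2 that by blast
    next
      case 3
      have "border p0 p3 \<noteq> border s t" using that by (intro diff) (auto simp: doubleton_eq_iff)
      then show ?thesis using 3 that assms(2) by blast
    qed
  qed
  have N: "q1 \<in> nbrs q0" "q2 \<in> nbrs q1" "q3 \<in> nbrs q2" "q0 \<in> nbrs q3"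
    "q0 \<in> nbrs q1" "q1 \<in> nbrs q2" "q2 \<in> nbrs q3" "q3 \<in> nbrs q0"
    "v \<in> border q0 q1" "v \<in> border q1 q2" "v \<in> border q2 q3" "v \<in> border q3 q0"
    "v \<in> border q1 q0" "v \<in> border q2 q1" "v \<in> border q3 q2" "v \<in> border q0 q3"
    "q0 \<noteq> q1" "q0 \<noteq> q2" "q0 \<noteq> q3" "q1 \<noteq> q2" "q1 \<noteq> q3" "q2 \<noteq> q3"
    "q1 \<noteq> q0" "q2 \<noteq> q0" "q3 \<noteq> q0" "q2 \<noteq> q1" "q3 \<noteq> q1" "q3 \<noteq> q2"
    by (simp_all add: q v border_def)
  consider "s = q0" "t = q1" | "s = q1" "t = q2" | "s = q2" "t = q3" | "s = q3" "t = q0"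
    | "s = q1" "t = q0" | "s = q2" "t = q1" | "s = q3" "t = q2" | "s = q0" "t = q3"
    using st by blast
  then show ?thesis
  proof cases
    case 1 show ?thesis by (rule turn[OF 1, of q2 q3]) (simp_all add: N)
  next
    case 2 show ?thesis by (rule turn[OF 2, of q3 q0]) (simp_all add: N)
  next
    case 3 show ?thesis by (rule turn[OF 3, of q0 q1]) (simp_all add: N)
  next
    case 4 show ?thesis by (rule turn[OF 4, of q1 q2]) (simp_all add: N)
  next
    case 5 show ?thesis by (rule turn[OF 5, of q3 q2]) (simp_all add: N)
  next
    case 6 show ?thesis by (rule turn[OF 6, of q0 q3]) (simp_all add: N)
  next
    case 7 show ?thesis by (rule turn[OF 7, of q1 q0]) (simp_all add: N)
  next
    case 8 show ?thesis by (rule turn[OF 8, of q2 q1]) (simp_all add: N)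
  qed
qed

definition loop_edges :: "'a list \<Rightarrow> 'a set set" where
  "loop_edges p = {{p ! i, p ! (Suc i mod length p)} |i. i < length p}"

lemma cycle_in_loop_edges: "cycle_in E p \<Longrightarrow> loop_edges p \<subseteq> E"
  by (auto simp: cycle_in_def loop_edges_def)

section \<open>Planar duality for spanning trees\<close>

text \<open>
  The combinatorial data of a planar region without holes. The last assumption replaces the Jordan
  curve theorem: a cycle \<open>p\<close> bounds a nonempty set \<open>Y\<close> of faces, which can be left only across edges
  of \<open>p\<close>.
\<close>

locale region =
  fixes F :: "(int \<times> int) set" and V :: "(int \<times> int) set" and E :: "(int \<times> int) set set"
  assumes finF: "finite F" and finV: "finite V"
    and E_eq: "E = {border s t |s t. s \<in> F \<and> t \<in> nbrs s}"
    and E_V: "\<Union>E \<subseteq> V"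
    and con: "ugraph_connected \<lparr>uverts = V, uedges = E\<rparr>"
    and interior: "\<And>p. cycle_in E p \<Longrightarrow>
      \<exists>Y\<subseteq>F. Y \<noteq> {} \<and> (\<forall>s\<in>Y. \<forall>t\<in>nbrs s. t \<notin> Y \<longrightarrow> border s t \<in> loop_edges p)"
begin

definition dual :: "(int \<times> int \<Rightarrow> int \<times> int) \<Rightarrow> (int \<times> int) set set" where
  "dual f = (\<lambda>s. border s (f s)) ` F"

definition exit_maps :: "(int \<times> int \<Rightarrow> int \<times> int) set" where
  "exit_maps = {f \<in> PiE F nbrs. ranked F f}"

lemma E_I: "s \<in> F \<Longrightarrow> t \<in> nbrs s \<Longrightarrow> border s t \<in> E"
  unfolding E_eq by blast

lemma E_doubleton: "e \<in> E \<Longrightarrow> \<exists>u v. u \<noteq> v \<and> e = {u, v}"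
  unfolding E_eq using border_doubleton by blast

lemma finE: "finite E"
proof -
  have "E = (\<Union>s\<in>F. border s ` nbrs s)" unfolding E_eq by blast
  then show ?thesis using finF by simp
qed

lemma exit_maps_nbrs: "f \<in> exit_maps \<Longrightarrow> s \<in> F \<Longrightarrow> f s \<in> nbrs s"
  unfolding exit_maps_def by blast

lemma dual_sub: "f \<in> exit_maps \<Longrightarrow> dual f \<subseteq> E"
  unfolding dual_def by (intro image_subsetI E_I exit_maps_nbrs)

lemma exit_maps_restrictI:
  fixes d :: "_ \<Rightarrow> nat"
  assumes "\<And>s. s \<in> F \<Longrightarrow> g s \<in> nbrs s" "\<And>s. s \<in> F \<Longrightarrow> d (g s) < d s"
  shows "restrict g F \<in> exit_maps"
proof -
  have "ranked F (restrict g F)" unfolding ranked_def using assms(2) by (intro exI[of _ d]) simp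
  moreover have "restrict g F \<in> PiE F nbrs" using assms(1) by (simp only: restrict_PiE_iff) blast
  ultimately show ?thesis unfolding exit_maps_def by blast
qed

text \<open>
  The two squares at an edge cannot both choose to cross it, as each would have a smaller rank than the
  other.
\<close>

lemma inj_border:
  assumes f: "f \<in> exit_maps"
  shows "inj_on (\<lambda>s. border s (f s)) F"
proof (rule inj_onI, rule ccontr)
  fix s t assume st: "s \<in> F" "t \<in> F" "border s (f s) = border t (f t)" "s \<noteq> t"
  obtain d :: "_ \<Rightarrow> nat" where d: "\<forall>s\<in>F. f s \<in> F \<longrightarrow> d (f s) < d s"
    using f unfolding exit_maps_def ranked_def by blast
  have "t = f s" "f t = s"
    using border_eq_iff[OF exit_maps_nbrs[OF f st(1)] exit_maps_nbrs[OF f st(2)]] st(3,4) by auto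
  then show False using d st(1,2) by (metis less_asym)
qed

lemma card_dual: "f \<in> exit_maps \<Longrightarrow> card (dual f) = card F"
  unfolding dual_def by (rule card_image[OF inj_border])

text \<open>
  The faces inside a cycle that avoids the edges of \<open>dual f\<close> would be mapped by \<open>f\<close> to themselves.
\<close>

lemma complement_acyclic:
  assumes f: "f \<in> exit_maps"
  shows "\<nexists>p. cycle_in (E - dual f) p"
proof
  assume "\<exists>p. cycle_in (E - dual f) p"
  then obtain p where p: "cycle_in (E - dual f) p" by blast
  then have "cycle_in E p" by (rule cycle_in_mono) blast
  then obtain Y where Y: "Y \<subseteq> F" "Y \<noteq> {}"
    and cl: "\<And>s t. s \<in> Y \<Longrightarrow> t \<in> nbrs s \<Longrightarrow> t \<notin> Y \<Longrightarrow> border s t \<in> loop_edges p"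
    using interior[of p] by blast
  have le: "loop_edges p \<subseteq> E - dual f" using cycle_in_loop_edges[OF p] .
  obtain d :: "_ \<Rightarrow> nat" where d: "\<forall>s\<in>F. f s \<in> F \<longrightarrow> d (f s) < d s"
    using f unfolding exit_maps_def ranked_def by blast
  obtain s where s: "s \<in> Y" and min: "\<And>t. t \<in> Y \<Longrightarrow> d s \<le> d t"
    using ex_has_least_nat[of "\<lambda>s. s \<in> Y" _ d] Y(2) by blast
  have "border s (f s) \<in> dual f" unfolding dual_def using s Y by blast
  then have "f s \<in> Y" using cl[OF s exit_maps_nbrs[OF f]] s Y le by blast
  then have "d (f s) < d s" using d s Y by blast
  then show False using min[OF \<open>f s \<in> Y\<close>] by simp
qed

text \<open>
  All edges leaving the connected component \<open>X\<close> of a vertex belong to \<open>dual f\<close>, so they have the form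
  \<open>border s (f s)\<close>. If there are any, let \<open>s\<close> have largest rank among the faces occurring here. A second
  side of \<open>s\<close> leaves \<open>X\<close> too. It can only be chosen by the face beyond it, which then has a larger rank.
\<close>

lemma complement_connected:
  assumes f: "f \<in> exit_maps"
  shows "ugraph_connected \<lparr>uverts = V, uedges = E - dual f\<rparr>"
proof -
  let ?T = "E - dual f"
  obtain d :: "_ \<Rightarrow> nat" where d: "\<forall>s\<in>F. f s \<in> F \<longrightarrow> d (f s) < d s"
    using f unfolding exit_maps_def ranked_def by blast
  have "(u, v) \<in> (adj ?T)\<^sup>*" if uv: "u \<in> V" "v \<in> V" for u v
  proof (rule ccontr)
    assume nv: "(u, v) \<notin> (adj ?T)\<^sup>*"
    define X where "X = {w. (u, w) \<in> (adj ?T)\<^sup>*}"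
    have Tcut: "e \<notin> ?T" if cut: "e \<in> E" "e \<inter> X \<noteq> {}" "\<not> e \<subseteq> X" for e
    proof
      assume e: "e \<in> ?T"
      obtain a b where ab: "e = {a, b}" "a \<in> X" "b \<notin> X"
      proof -
        obtain x y where xy: "e = {x, y}" using E_doubleton[OF cut(1)] by blast
        then consider "x \<in> X" "y \<notin> X" | "y \<in> X" "x \<notin> X" using cut(2,3) by auto
        then show ?thesis
          using that[of x y] that[of y x] xy by (metis insert_commute)
      qed
      then have "(a, b) \<in> adj ?T" using e by simp
      then have "b \<in> X" using ab(2) unfolding X_def by (simp add: rtrancl_into_rtrancl)
      then show False using ab by simp
    qed
    have "(u, v) \<in> (adj E)\<^sup>*" using con uv by (simp add: ugraph_connected_def)
    then have "v \<notin> X \<longrightarrow> (\<exists>e\<in>E. e \<inter> X \<noteq> {} \<and> \<not> e \<subseteq> X)"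
    proof (induction rule: rtrancl_induct)
      case base
      then show ?case by (simp add: X_def)
    next
      case (step y z)
      show ?case
      proof (cases "y \<in> X")
        case True
        then show ?thesis using step(2) by (intro impI bexI[of _ "{y, z}"]) auto
      qed (use step in blast)
    qed
    then obtain e0 where e0: "e0 \<in> E" "e0 \<inter> X \<noteq> {}" "\<not> e0 \<subseteq> X"
      using nv unfolding X_def by blast
    define A where "A = {s \<in> F. border s (f s) \<inter> X \<noteq> {} \<and> \<not> border s (f s) \<subseteq> X}"
    have "e0 \<in> dual f" using Tcut[OF e0] e0(1) by blast
    then have "A \<noteq> {}" using e0 unfolding dual_def A_def by blast
    moreover have finA: "finite A" unfolding A_def using finF by simp
    ultimately have "Max (d ` A) \<in> d ` A" by (intro Max_in) auto
    then obtain s where s: "s \<in> A" "d s = Max (d ` A)" by (metis imageE)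
    have max: "d t \<le> d s" if "t \<in> A" for t
      unfolding s(2) using finA that by (intro Max_ge) auto
    have sF: "s \<in> F" using s(1) unfolding A_def by blast
    obtain t where t: "t \<in> nbrs s" "t \<noteq> f s" "border s t \<inter> X \<noteq> {}" "\<not> border s t \<subseteq> X"
      using face_second_cut_edge[OF exit_maps_nbrs[OF f sF], of X] s(1) unfolding A_def by blast
    have "border s t \<in> dual f" using Tcut[OF E_I[OF sF t(1)] t(3,4)] E_I[OF sF t(1)] by blast
    then obtain s' where s': "s' \<in> F" "border s t = border s' (f s')" unfolding dual_def by blast
    have "s' = t" "f s' = s"
      using border_eq_iff[OF t(1) exit_maps_nbrs[OF f s'(1)]] s'(2) t(2) by auto
    then have "s' \<in> A" "d s < d s'" using s' t d sF unfolding A_def by auto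
    then show False using max by fastforce
  qed
  moreover have "V \<noteq> {}" using con by (simp add: ugraph_connected_def)
  ultimately show ?thesis by (simp add: ugraph_connected_def)
qed

lemma complement_tree: "f \<in> exit_maps \<Longrightarrow> ugraph_tree \<lparr>uverts = V, uedges = E - dual f\<rparr>"
  unfolding ugraph_tree_def using complement_acyclic complement_connected by simp

text \<open>
  The map can be read off its edges by induction on the rank: the edge \<open>border s (f s)\<close> must be chosen in
  \<open>g\<close> by \<open>s\<close> or by \<open>f s\<close>, but \<open>g\<close> agrees with \<open>f\<close> at \<open>f s\<close> and so makes \<open>f s\<close> choose another edge.
\<close>

lemma complement_inj: "inj_on (\<lambda>f. E - dual f) exit_maps"
proof (rule inj_onI)
  fix f g assume fg: "f \<in> exit_maps" "g \<in> exit_maps" "E - dual f = E - dual g"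
  have eq: "dual f = dual g" using fg dual_sub by blast
  obtain d :: "_ \<Rightarrow> nat" where d: "\<forall>s\<in>F. f s \<in> F \<longrightarrow> d (f s) < d s"
    using fg(1) unfolding exit_maps_def ranked_def by blast
  have "f s = g s" if "s \<in> F" for s
    using that
  proof (induction "d s" arbitrary: s rule: less_induct)
    case less
    have "border s (f s) \<in> dual f" using less.prems unfolding dual_def by blast
    then have "border s (f s) \<in> dual g" by (simp only: eq)
    then obtain s' where s': "s' \<in> F" "border s (f s) = border s' (g s')" unfolding dual_def by blast
    consider "s' = s" "g s' = f s" | "s' = f s" "g s' = s"
      using border_eq_iff[OF exit_maps_nbrs[OF fg(1) less.prems] exit_maps_nbrs[OF fg(2) s'(1)]] s'(2) by blast
    then show ?case
    proof cases
      case 2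
      then have "f s' = s" using less.hyps[of s'] d less.prems s'(1) by auto
      then have "border s' (f s') = border s (f s)" using 2 by (simp add: border_sym)
      then have "s' = s" using inj_border[OF fg(1)] s'(1) less.prems by (simp add: inj_on_def)
      then show ?thesis using 2 exit_maps_nbrs[OF fg(1) less.prems] by simp
    qed simp
  qed
  then show "f = g" using fg(1,2) unfolding exit_maps_def by (intro PiE_ext[of f F nbrs g]) auto
qed

text \<open>
  From every face one can get out of the region by crossing only edges that are not in \<open>T\<close>. Otherwise
  the faces for which this fails have a boundary contained in \<open>T\<close>; each vertex on that boundary has
  degree at least two in it, which yields a cycle. Shortest ways out then define a map \<open>f\<close>. The tree
  \<open>E - dual f\<close> contains the tree \<open>T\<close>, so they are equal.
\<close>

lemma complement_surj:
  assumes T: "T \<subseteq> E" and tree: "ugraph_tree \<lparr>uverts = V, uedges = T\<rparr>"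
  shows "\<exists>f\<in>exit_maps. T = E - dual f"
proof -
  have acyc: "\<nexists>p. cycle_in T p" and tcon: "\<And>u v. u \<in> V \<Longrightarrow> v \<in> V \<Longrightarrow> (u, v) \<in> (adj T)\<^sup>*"
    using tree by (auto simp: ugraph_tree_def ugraph_connected_def)
  define R where "R = {(s, t). s \<in> F \<and> t \<in> nbrs s \<and> border s t \<in> E - T}"
  define X where "X = {s \<in> F. \<nexists>t. t \<notin> F \<and> (s, t) \<in> R\<^sup>*}"
  have "X = {}"
  proof (rule ccontr)
    assume X: "X \<noteq> {}"
    define B where "B = {border s t |s t. s \<in> X \<and> t \<in> nbrs s \<and> t \<notin> X}"
    have BT: "B \<subseteq> T"
    proof
      fix e assume "e \<in> B"
      then obtain s t where st: "e = border s t" "s \<in> X" "t \<in> nbrs s" "t \<notin> X" unfolding B_def by blast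
      show "e \<in> T"
      proof (rule ccontr)
        assume "e \<notin> T"
        then have r: "(s, t) \<in> R" using st E_I unfolding R_def X_def by blast
        show False
        proof (cases "t \<in> F")
          case True
          then obtain w where "w \<notin> F" "(t, w) \<in> R\<^sup>*" using st(4) unfolding X_def by blast
          then show False using r st(2) unfolding X_def by (blast intro: converse_rtrancl_into_rtrancl)
        next
          case False
          then show False using r st(2) unfolding X_def by blast
        qed
      qed
    qed
    have finX: "finite X" unfolding X_def using finF by simp
    have "B \<noteq> {}"
    proof -
      define m where "m = Max (fst ` X)"
      have "m \<in> fst ` X" unfolding m_def using finX X by (intro Max_in) auto
      then obtain y where y: "(m, y) \<in> X" by force
      have "(m + 1, y) \<notin> X"
      proof
        assume "(m + 1, y) \<in> X"
        then have "m + 1 \<in> fst ` X" by force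
        then have "m + 1 \<le> m" unfolding m_def using finX by (intro Max_ge) auto
        then show False by simp
      qed
      moreover have "(m + 1, y) \<in> nbrs (m, y)" by simp
      ultimately show ?thesis using y unfolding B_def by blast
    qed
    moreover have "finite B" by (rule finite_subset[OF order_trans[OF BT T] finE])
    ultimately have "\<exists>p. cycle_in B p"
    proof (intro min_degree_two_cycle)
      show "\<exists>u v. u \<noteq> v \<and> e = {u, v}" if "e \<in> B" for e using that BT T E_doubleton by blast
      fix e v assume "e \<in> B" "v \<in> e"
      then obtain s t where st: "e = border s t" "s \<in> X" "t \<in> nbrs s" "t \<notin> X" "v \<in> border s t"
        unfolding B_def by blast
      show "\<exists>e'\<in>B. e' \<noteq> e \<and> v \<in> e'"
        using vertex_second_boundary_edge[OF st(3,2,4,5)] unfolding B_def st(1) by blast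
    qed auto
    then show False using cycle_in_mono[OF _ BT] acyc by blast
  qed
  then have "\<exists>t. t \<notin> F \<and> (s, t) \<in> R\<^sup>*" if "s \<in> F" for s using that unfolding X_def by blast
  then obtain f0 and d :: "_ \<Rightarrow> nat" where "\<forall>s\<in>F. (s, f0 s) \<in> R \<and> d (f0 s) < d s"
    using ex_rank_towards_exit[of F R] by blast
  then have f0: "\<And>s. s \<in> F \<Longrightarrow> (s, f0 s) \<in> R" and d: "\<And>s. s \<in> F \<Longrightarrow> d (f0 s) < d s" by blast+
  define f where "f = restrict f0 F"
  have f: "f \<in> exit_maps"
    unfolding f_def using f0 d by (intro exit_maps_restrictI[of _ d]) (auto simp: R_def simp del: nbrs.simps)
  have TT: "T \<subseteq> E - dual f" using T f0 unfolding dual_def f_def R_def by auto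
  moreover have "E - dual f \<subseteq> T"
  proof
    fix e assume e: "e \<in> E - dual f"
    then obtain u v where uv: "u \<noteq> v" "e = {u, v}" using E_doubleton by blast
    then have "(u, v) \<in> (adj T)\<^sup>*" using tcon e E_V by blast
    then show "e \<in> T"
      using acyclic_edge_in_connected_subgraph[OF complement_acyclic[OF f] TT] e uv by blast
  qed
  ultimately show ?thesis using f by blast
qed

lemma spanning_trees_eq: "\<tau> \<lparr>uverts = V, uedges = E\<rparr> = card {f \<in> PiE F nbrs. ranked F f}"
proof -
  have "{T. T \<subseteq> E \<and> ugraph_tree \<lparr>uverts = V, uedges = T\<rparr>} = (\<lambda>f. E - dual f) ` exit_maps"
    using complement_surj complement_tree by auto
  then show ?thesis
    unfolding num_spanning_trees_def
    by (simp add: card_image[OF complement_inj] del: Collect_conj_eq) (simp add: exit_maps_def)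
qed

text \<open>
  Always step to the right.
\<close>

lemma exit_maps_nonempty: "exit_maps \<noteq> {}"
proof -
  define d where "d = (\<lambda>s :: int \<times> int. nat (Max (fst ` F) + 1 - fst s))"
  have "restrict (\<lambda>s. (fst s + 1, snd s)) F \<in> exit_maps"
  proof (rule exit_maps_restrictI)
    fix s assume s: "s \<in> F"
    show "(fst s + 1, snd s) \<in> nbrs s" by (cases s) simp
    have "fst s \<le> Max (fst ` F)" using s finF by (intro Max_ge) auto
    then show "d (fst s + 1, snd s) < d s" unfolding d_def by simp
  qed
  then show ?thesis by blast
qed

lemma euler: "card E + 1 = card V + card F"
proof -
  obtain f where f: "f \<in> exit_maps" using exit_maps_nonempty by blast
  have "card (E - dual f) + 1 = card V"
    using complement_tree[OF f] finV by (rule tree_card) (use E_V E_doubleton in blast)+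
  moreover have "card E = card (E - dual f) + card (dual f)"
    using dual_sub[OF f] finE by (metis card_Diff_subset card_mono finite_subset le_add_diff_inverse2)
  ultimately show ?thesis using card_dual[OF f] by simp
qed

end

section \<open>Lattice polygons as Jordan curves\<close>

fun open_square :: "int \<times> int \<Rightarrow> complex set" where
  "open_square (x, y) = box (pt (x, y)) (pt (x + 1, y + 1))"

fun closed_square :: "int \<times> int \<Rightarrow> complex set" where
  "closed_square (x, y) = cbox (pt (x, y)) (pt (x + 1, y + 1))"

definition edge_segment :: "(int \<times> int) set \<Rightarrow> complex set" where
  "edge_segment e = convex hull (pt ` e)"

lemma in_open_square_iff: "z \<in> open_square (x, y) \<longleftrightarrow>
    real_of_int x < Re z \<and> Re z < real_of_int x + 1 \<and> real_of_int y < Im z \<and> Im z < real_of_int y + 1"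
  by (auto simp: mem_box Basis_complex_def pt_def)

lemma in_closed_square_iff: "z \<in> closed_square (x, y) \<longleftrightarrow>
    real_of_int x \<le> Re z \<and> Re z \<le> real_of_int x + 1 \<and> real_of_int y \<le> Im z \<and> Im z \<le> real_of_int y + 1"
  by (auto simp: mem_box Basis_complex_def pt_def)

lemmas squares_iff = in_open_square_iff in_closed_square_iff
declare open_square.simps [simp del] closed_square.simps [simp del]

lemma open_square_connected: "connected (open_square s)"
  by (cases s) (simp only: open_square.simps convex_connected[OF convex_box(2)])

lemma open_square_nonempty: "open_square s \<noteq> {}"
proof -
  obtain x y where s: "s = (x, y)" by force
  have "Complex (real_of_int x + 1 / 2) (real_of_int y + 1 / 2) \<in> open_square (x, y)"
    unfolding in_open_square_iff by simp
  then show ?thesis unfolding s by blast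
qed

lemma closure_open_square: "closure (open_square s) = closed_square s"
proof -
  obtain x y where s: "s = (x, y)" by force
  show ?thesis using open_square_nonempty[of s] unfolding s open_square.simps closed_square.simps by (rule closure_box)
qed

lemma pt_eq_iff [simp]: "pt u = pt v \<longleftrightarrow> u = v"
  by (cases u; cases v) (simp add: pt_def)

lemma edge_segment_doubleton: "edge_segment {u, v} = closed_segment (pt u) (pt v)"
  by (simp add: edge_segment_def segment_convex_hull)

lemma edge_segment_horizontal: "z \<in> edge_segment {(x, y), (x + 1, y)} \<longleftrightarrow>
    Im z = real_of_int y \<and> real_of_int x \<le> Re z \<and> Re z \<le> real_of_int x + 1"
proof -
  have "closed_segment (pt (x, y)) (pt (x + 1, y)) =
      {z. Im z = Im (pt (x, y)) \<and> Re z \<in> closed_segment (Re (pt (x, y))) (Re (pt (x + 1, y)))}"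
    by (rule closed_segment_same_Im) (simp add: pt_def)
  then show ?thesis unfolding edge_segment_doubleton by (simp add: pt_def closed_segment_eq_real_ivl)
qed

lemma edge_segment_vertical: "z \<in> edge_segment {(x, y), (x, y + 1)} \<longleftrightarrow>
    Re z = real_of_int x \<and> real_of_int y \<le> Im z \<and> Im z \<le> real_of_int y + 1"
proof -
  have "closed_segment (pt (x, y)) (pt (x, y + 1)) =
      {z. Re z = Re (pt (x, y)) \<and> Im z \<in> closed_segment (Im (pt (x, y))) (Im (pt (x, y + 1)))}"
    by (rule closed_segment_same_Re) (simp add: pt_def)
  then show ?thesis unfolding edge_segment_doubleton by (simp add: pt_def closed_segment_eq_real_ivl)
qed

lemma lattice_edges_cases:
  assumes "e \<in> lattice_edges"
  obtains x y where "e = {(x, y), (x + 1, y)}" | x y where "e = {(x, y), (x, y + 1)}"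
proof -
  obtain u v where uv: "e = {u, v}" "dist (pt u) (pt v) = 1"
    using assms unfolding lattice_edges_def by blast
  obtain x y x' y' where c: "u = (x, y)" "v = (x', y')" by force
  have "(norm (pt u - pt v))\<^sup>2 = 1" using uv by (simp add: dist_norm)
  then have "real_of_int ((x - x')\<^sup>2 + (y - y')\<^sup>2) = 1"
    by (simp add: c pt_def cmod_power2)
  then have s: "(x - x')\<^sup>2 + (y - y')\<^sup>2 = 1" by linarith
  have "\<bar>x - x'\<bar> \<le> 1" "\<bar>y - y'\<bar> \<le> 1"
    using s by (metis abs_le_square_iff abs_one le_add_same_cancel1 le_add_same_cancel2 one_power2 zero_le_power2)+
  then have "x - x' \<in> {-1, 0, 1}" "y - y' \<in> {-1, 0, 1}" by auto
  with s have "(x' = x + 1 \<or> x = x' + 1) \<and> y' = y \<or> x' = x \<and> (y' = y + 1 \<or> y = y' + 1)"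
    by auto
  then show thesis using that uv(1) c by (auto simp: insert_commute)
qed

lemma unit_edges_lattice:
  "{(x, y), (x + 1, y)} \<in> lattice_edges" "{(x, y), (x, y + 1)} \<in> lattice_edges"
  unfolding lattice_edges_def by (force simp: pt_def dist_norm cmod_def)+

lemma lattice_edge_border:
  assumes "e \<in> lattice_edges"
  obtains s t where "t \<in> nbrs s" "e = border s t"
  using assms
proof (cases rule: lattice_edges_cases)
  case (1 x y)
  show ?thesis using that[of "(x, y - 1)" "(x, y)"] 1 by (simp add: border_simps)
next
  case (2 x y)
  show ?thesis using that[of "(x - 1, y)" "(x, y)"] 2 by (simp add: border_simps)
qed

lemma border_lattice: "t \<in> nbrs s \<Longrightarrow> border s t \<in> lattice_edges"
  by (cases s) (auto simp: border_simps unit_edges_lattice)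

lemma edge_segment_border_sub: "t \<in> nbrs s \<Longrightarrow> edge_segment (border s t) \<subseteq> closed_square s"
  by (cases s) (auto simp: border_simps edge_segment_horizontal edge_segment_vertical squares_iff)

lemma edge_segment_Int:
  assumes "e \<in> lattice_edges" "e' \<in> lattice_edges" "e \<noteq> e'"
  shows "edge_segment e \<inter> edge_segment e' \<subseteq> pt ` (e \<inter> e')"
proof
  fix z assume z: "z \<in> edge_segment e \<inter> edge_segment e'"
  have key: "z \<in> pt ` (e \<inter> e')" if "Re z = real_of_int a" "Im z = real_of_int b" "(a, b) \<in> e" "(a, b) \<in> e'" for a b
  proof -
    have "z = pt (a, b)" using that by (simp add: pt_def complex_eq_iff)
    then show ?thesis using that by blast
  qed
  show "z \<in> pt ` (e \<inter> e')"
  proof (rule lattice_edges_cases[OF assms(1)]; rule lattice_edges_cases[OF assms(2)])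
    fix x y x' y' assume e: "e = {(x, y), (x + 1, y)}" "e' = {(x', y'), (x' + 1, y')}"
    have c: "Im z = y'" "Im z = y" "real_of_int x \<le> Re z" "Re z \<le> real_of_int x + 1"
      "real_of_int x' \<le> Re z" "Re z \<le> real_of_int x' + 1"
      using z unfolding e Int_iff edge_segment_horizontal by blast+
    then have y: "y' = y" by simp
    then have "x' \<noteq> x" using assms(3) e by blast
    with c consider "x' = x + 1" | "x = x' + 1" by linarith
    then show ?thesis
    proof cases
      case 1 show ?thesis by (rule key[of "x + 1" y]) (use 1 c y in \<open>simp_all add: e\<close>)
    next
      case 2 show ?thesis by (rule key[of x y]) (use 2 c y in \<open>simp_all add: e\<close>)
    qed
  next
    fix x y x' y' assume e: "e = {(x, y), (x + 1, y)}" "e' = {(x', y'), (x', y' + 1)}"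
    have c: "Im z = y" "real_of_int x \<le> Re z" "Re z \<le> real_of_int x + 1"
      "real_of_int y' \<le> Im z" "Im z \<le> real_of_int y' + 1" "Re z = x'"
      using z unfolding e Int_iff edge_segment_horizontal edge_segment_vertical by blast+
    then have "x' = x \<or> x' = x + 1" "y = y' \<or> y = y' + 1" using c by linarith+
    then have "(x', y) \<in> e" "(x', y) \<in> e'" unfolding e by blast+
    then show ?thesis by (rule key[OF c(6,1)])
  next
    fix x y x' y' assume e: "e = {(x, y), (x, y + 1)}" "e' = {(x', y'), (x' + 1, y')}"
    have c: "Im z = y'" "real_of_int x' \<le> Re z" "Re z \<le> real_of_int x' + 1"
      "real_of_int y \<le> Im z" "Im z \<le> real_of_int y + 1" "Re z = x"
      using z unfolding e Int_iff edge_segment_horizontal edge_segment_vertical by blast+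
    then have "x = x' \<or> x = x' + 1" "y' = y \<or> y' = y + 1" using c by linarith+
    then have "(x, y') \<in> e" "(x, y') \<in> e'" unfolding e by blast+
    then show ?thesis by (rule key[OF c(6,1)])
  next
    fix x y x' y' assume e: "e = {(x, y), (x, y + 1)}" "e' = {(x', y'), (x', y' + 1)}"
    have c: "Re z = x'" "Re z = x" "real_of_int y \<le> Im z" "Im z \<le> real_of_int y + 1"
      "real_of_int y' \<le> Im z" "Im z \<le> real_of_int y' + 1"
      using z unfolding e Int_iff edge_segment_vertical by blast+
    then have x: "x' = x" by simp
    then have "y' \<noteq> y" using assms(3) e by blast
    with c consider "y' = y + 1" | "y = y' + 1" by linarith
    then show ?thesis
    proof cases
      case 1 show ?thesis by (rule key[of x "y + 1"]) (use 1 c x in \<open>simp_all add: e\<close>)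
    next
      case 2 show ?thesis by (rule key[of x y]) (use 2 c x in \<open>simp_all add: e\<close>)
    qed
  qed
qed

lemma lattice_edge_neq: "{u, v} \<in> lattice_edges \<Longrightarrow> u \<noteq> v"
  by (auto simp: lattice_edges_def doubleton_eq_iff)

definition path_edges :: "'a list \<Rightarrow> 'a set set" where
  "path_edges p = (\<lambda>i. {p ! i, p ! Suc i}) ` {i. Suc i < length p}"

lemma path_edges_single [simp]: "path_edges [a] = {}"
  by (simp add: path_edges_def)

lemma path_edges_Cons [simp]: "path_edges (a # b # r) = insert {a, b} (path_edges (b # r))"
proof -
  have "{i. Suc i < length (a # b # r)} = insert 0 (Suc ` {i. Suc i < length (b # r)})"
    by (auto simp: less_Suc_eq_0_disj)
  then show ?thesis unfolding path_edges_def by (simp add: image_image)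
qed

lemma path_edges_subset: "e \<in> path_edges p \<Longrightarrow> e \<subseteq> set p"
  by (auto simp: path_edges_def)

fun polygonal_path :: "(int \<times> int) list \<Rightarrow> real \<Rightarrow> complex" where
  "polygonal_path (a # b # c # r) = linepath (pt a) (pt b) +++ polygonal_path (b # c # r)"
| "polygonal_path p = linepath (pt (hd p)) (pt (last p))"

lemma arc_polygonal_path:
  assumes "length p \<ge> 2" "distinct p" "path_edges p \<subseteq> lattice_edges"
  shows "arc (polygonal_path p) \<and> pathstart (polygonal_path p) = pt (hd p) \<and> pathfinish (polygonal_path p) = pt (last p) \<and>
    path_image (polygonal_path p) = (\<Union>e\<in>path_edges p. edge_segment e)"
  using assms
proof (induction p rule: polygonal_path.induct)
  case (1 a b c r)
  have pe: "path_edges (b # c # r) \<subseteq> lattice_edges" "{a, b} \<in> lattice_edges"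
    using "1.prems"(3) unfolding path_edges_Cons[of a b] by blast+
  have dis: "distinct (b # c # r)" "a \<notin> set (b # c # r)" using "1.prems"(2) by simp_all
  have "length (b # c # r) \<ge> 2" by simp
  from "1.IH"[OF this dis(1) pe(1)]
  have IH: "arc (polygonal_path (b # c # r))" "pathstart (polygonal_path (b # c # r)) = pt b"
    "pathfinish (polygonal_path (b # c # r)) = pt (last (b # c # r))"
    "path_image (polygonal_path (b # c # r)) = (\<Union>e\<in>path_edges (b # c # r). edge_segment e)" by simp_all
  have "arc (linepath (pt a) (pt b))" using dis(2) by (intro arc_linepath) simp
  moreover have "path_image (linepath (pt a) (pt b)) \<inter> path_image (polygonal_path (b # c # r)) \<subseteq> {pathstart (polygonal_path (b # c # r))}"
  proof
    fix z assume "z \<in> path_image (linepath (pt a) (pt b)) \<inter> path_image (polygonal_path (b # c # r))"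
    then obtain e where e: "e \<in> path_edges (b # c # r)" "z \<in> edge_segment e" "z \<in> edge_segment {a, b}"
      unfolding IH path_image_linepath edge_segment_doubleton by blast
    have sub: "e \<subseteq> set (b # c # r)" using path_edges_subset[OF e(1)] .
    then have ne: "{a, b} \<noteq> e" using dis(2) by blast
    have "e \<in> lattice_edges" using pe(1) e(1) by blast
    then have "z \<in> pt ` ({a, b} \<inter> e)" using edge_segment_Int[OF pe(2) _ ne] e by blast
    moreover have "{a, b} \<inter> e \<subseteq> {b}" using sub dis(2) by blast
    ultimately show "z \<in> {pathstart (polygonal_path (b # c # r))}" unfolding IH by blast
  qed
  ultimately have "arc (polygonal_path (a # b # c # r))"
    unfolding polygonal_path.simps(1) using IH by (intro arc_join) simp_all
  moreover have "path_image (polygonal_path (a # b # c # r)) = (\<Union>e\<in>path_edges (a # b # c # r). edge_segment e)"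
    unfolding polygonal_path.simps(1) path_edges_Cons[of a b]
    using IH by (simp add: path_image_join edge_segment_doubleton del: path_edges_Cons)
  ultimately show ?case using IH by simp
next
  case "2_1"
  then show ?case by simp
next
  case ("2_2" a)
  then show ?case by simp
next
  case ("2_3" a b)
  then have "arc (linepath (pt a) (pt b))" by (intro arc_linepath) simp
  then show ?case by (simp only: polygonal_path.simps path_edges_Cons path_edges_single) (simp add: edge_segment_doubleton)
qed

lemma loop_edges_image: "loop_edges p = (\<lambda>i. {p ! i, p ! (Suc i mod length p)}) ` {..<length p}"
  unfolding loop_edges_def lessThan_def by (rule setcompr_eq_image)

lemma loop_edges_eq:
  assumes "length p > 2"
  shows "loop_edges p = insert {last p, hd p} (path_edges p)"
proof -
  note loop_edges_image[of p]
  also have "{..<length p} = insert (length p - 1) {i. Suc i < length p}" using assms by auto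
  also have "(\<lambda>i. {p ! i, p ! (Suc i mod length p)}) ` \<dots> = insert {last p, hd p} (path_edges p)"
  proof -
    have "p \<noteq> []" using assms by auto
    then have "{p ! (length p - 1), p ! (Suc (length p - 1) mod length p)} = {last p, hd p}"
      using assms by (simp add: last_conv_nth hd_conv_nth)
    moreover have "(\<lambda>i. {p ! i, p ! (Suc i mod length p)}) ` {i. Suc i < length p} = path_edges p"
      unfolding path_edges_def by (rule image_cong) simp_all
    ultimately show ?thesis by simp
  qed
  finally show ?thesis .
qed

lemma loop_curve_eq: "loop_curve \<alpha> = (\<Union>e\<in>loop_edges \<alpha>. edge_segment e)"
  unfolding loop_curve_def loop_edges_image by (simp add: edge_segment_doubleton)

lemma loop_simple_path:
  assumes "simple_closed_loop \<alpha>"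
  obtains c where "simple_path c" "pathfinish c = pathstart c" "path_image c = loop_curve \<alpha>"
proof -
  have len: "length \<alpha> > 2" and dis: "distinct \<alpha>" and le: "loop_edges \<alpha> \<subseteq> lattice_edges"
    using assms cycle_in_loop_edges[of lattice_edges \<alpha>]
    unfolding simple_closed_loop_def cycle_in_def by blast+
  note eq = loop_edges_eq[OF len]
  have a: "arc (polygonal_path \<alpha>)" "pathstart (polygonal_path \<alpha>) = pt (hd \<alpha>)" "pathfinish (polygonal_path \<alpha>) = pt (last \<alpha>)"
    "path_image (polygonal_path \<alpha>) = (\<Union>e\<in>path_edges \<alpha>. edge_segment e)"
    using arc_polygonal_path[of \<alpha>] len dis le unfolding eq by simp_all
  let ?e = "{last \<alpha>, hd \<alpha>}"
  have neq: "e \<noteq> ?e" if e: "e \<in> path_edges \<alpha>" for e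
  proof
    assume "e = ?e"
    then obtain i where i: "Suc i < length \<alpha>" "{\<alpha> ! i, \<alpha> ! Suc i} = {\<alpha> ! (length \<alpha> - 1), \<alpha> ! 0}"
      using e len unfolding path_edges_def by (auto simp: last_conv_nth hd_conv_nth simp flip: length_greater_0_conv)
    have n: "length \<alpha> - 1 < length \<alpha>" "0 < length \<alpha>" "i < length \<alpha>" using len i by auto
    have "i = length \<alpha> - 1 \<and> Suc i = 0 \<or> i = 0 \<and> Suc i = length \<alpha> - 1"
      using i(2) n i(1) by (simp add: doubleton_eq_iff nth_eq_iff_index_eq[OF dis])
    then show False using len by linarith
  qed
  have "simple_path (polygonal_path \<alpha> +++ linepath (pt (last \<alpha>)) (pt (hd \<alpha>)))"
  proof (rule simple_path_join_loop)
    show "arc (linepath (pt (last \<alpha>)) (pt (hd \<alpha>)))"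
      using lattice_edge_neq[of "last \<alpha>" "hd \<alpha>"] le eq by (intro arc_linepath) auto
    show "path_image (polygonal_path \<alpha>) \<inter> path_image (linepath (pt (last \<alpha>)) (pt (hd \<alpha>)))
        \<subseteq> {pathstart (polygonal_path \<alpha>), pathstart (linepath (pt (last \<alpha>)) (pt (hd \<alpha>)))}"
    proof
      fix z assume "z \<in> path_image (polygonal_path \<alpha>) \<inter> path_image (linepath (pt (last \<alpha>)) (pt (hd \<alpha>)))"
      then obtain e where e: "e \<in> path_edges \<alpha>" "z \<in> edge_segment e" "z \<in> edge_segment ?e"
        unfolding a path_image_linepath edge_segment_doubleton by blast
      then have "z \<in> pt ` (e \<inter> ?e)" using edge_segment_Int[of e ?e] neq[OF e(1)] le eq by auto
      then show "z \<in> {pathstart (polygonal_path \<alpha>), pathstart (linepath (pt (last \<alpha>)) (pt (hd \<alpha>)))}"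
        unfolding a by auto
    qed
  qed (simp_all add: a(1-3))
  moreover have "path_image (polygonal_path \<alpha> +++ linepath (pt (last \<alpha>)) (pt (hd \<alpha>))) = loop_curve \<alpha>"
    using a by (simp add: path_image_join loop_curve_eq eq edge_segment_doubleton) blast
  ultimately show thesis using a by (intro that) auto
qed

text \<open>
  The ball around the midpoint \<open>m\<close> of the common side serves to pass from one square to the other. It
  meets no lattice line except in that side, and it contains no lattice point.
\<close>

lemma border_crossing_ball:
  assumes "t \<in> nbrs s"
  obtains m where "m \<in> edge_segment (border s t)" "ball m (1/2) \<subseteq> open_square s \<union> open_square t \<union> edge_segment (border s t)"
    "ball m (1/2) \<inter> open_square s \<noteq> {}" "ball m (1/2) \<inter> open_square t \<noteq> {}" "ball m (1/2) \<inter> range pt = {}"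
proof -
  have ball: "\<bar>Re z - Re m\<bar> < 1/2 \<and> \<bar>Im z - Im m\<bar> < 1/2" if "z \<in> ball m (1/2)" for z m :: complex
  proof -
    have "norm (z - m) < 1/2" using that by (simp add: dist_norm norm_minus_commute)
    then show ?thesis using abs_Re_le_cmod[of "z - m"] abs_Im_le_cmod[of "z - m"] by simp
  qed
  have ballR: "Complex (Re m + 1/4) (Im m) \<in> ball m (1/2)" "Complex (Re m - 1/4) (Im m) \<in> ball m (1/2)"
    and ballI: "Complex (Re m) (Im m + 1/4) \<in> ball m (1/2)" "Complex (Re m) (Im m - 1/4) \<in> ball m (1/2)" for m
    by (simp_all add: dist_norm cmod_def)
  define P where "P = (\<lambda>s t m. m \<in> edge_segment (border s t) \<and> ball m (1/2) \<subseteq> open_square s \<union> open_square t \<union> edge_segment (border s t) \<and>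
    ball m (1/2) \<inter> open_square s \<noteq> {} \<and> ball m (1/2) \<inter> open_square t \<noteq> {} \<and> ball m (1/2) \<inter> range pt = {})"
  have P_sym: "P t s m" if "P s t m" for s t m
    using that unfolding P_def border_sym[of t s] Un_commute[of "open_square t" "open_square s"]
    by (elim conjE) (intro conjI)
  have vert: "\<exists>m. P (x, y) (x + 1, y) m" for x y
  proof -
    define m where "m = Complex (real_of_int x + 1) (real_of_int y + 1/2)"
    have 1: "m \<in> edge_segment (border (x, y) (x + 1, y))" by (simp add: border_simps edge_segment_vertical m_def)
    have 2: "ball m (1/2) \<subseteq> open_square (x, y) \<union> open_square (x + 1, y) \<union> edge_segment (border (x, y) (x + 1, y))"
    proof
      fix z assume "z \<in> ball m (1/2)"
      from ball[OF this] have h: "real_of_int x + 1/2 < Re z" "Re z < real_of_int x + 3/2"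
        "real_of_int y < Im z" "Im z < real_of_int y + 1" unfolding m_def complex.sel by linarith+
      consider "Re z < real_of_int x + 1" | "Re z = real_of_int x + 1" | "Re z > real_of_int x + 1" by linarith
      then show "z \<in> open_square (x, y) \<union> open_square (x + 1, y) \<union> edge_segment (border (x, y) (x + 1, y))"
      proof cases
        case 1
        then have "z \<in> open_square (x, y)" unfolding in_open_square_iff using h by simp
        then show ?thesis by blast
      next
        case 2
        then have "z \<in> edge_segment (border (x, y) (x + 1, y))" unfolding border_simps edge_segment_vertical using h by simp
        then show ?thesis by blast
      next
        case 3
        then have "z \<in> open_square (x + 1, y)" unfolding in_open_square_iff using h by simp
        then show ?thesis by blast
      qed
    qed
    have 3: "Complex (Re m - 1/4) (Im m) \<in> open_square (x, y)" "Complex (Re m + 1/4) (Im m) \<in> open_square (x + 1, y)"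
      by (simp_all add: m_def squares_iff)
    have "pt v \<notin> ball m (1/2)" for v
    proof
      assume "pt v \<in> ball m (1/2)"
      from ball[OF this] have "\<bar>real_of_int (snd v) - (real_of_int y + 1/2)\<bar> < 1/2" by (simp add: pt_def m_def)
      then have "real_of_int y < real_of_int (snd v)" "real_of_int (snd v) < real_of_int (y + 1)"
        unfolding abs_less_iff of_int_add by linarith+
      then show False unfolding of_int_less_iff by linarith
    qed
    then have 4: "ball m (1/2) \<inter> range pt = {}" by blast
    have "ball m (1/2) \<inter> open_square (x, y) \<noteq> {}" "ball m (1/2) \<inter> open_square (x + 1, y) \<noteq> {}"
      using 3 ballR[of m] by blast+
    with 1 2 4 have "P (x, y) (x + 1, y) m" unfolding P_def by (intro conjI)
    then show ?thesis ..
  qed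
  have horz: "\<exists>m. P (x, y) (x, y + 1) m" for x y
  proof -
    define m where "m = Complex (real_of_int x + 1/2) (real_of_int y + 1)"
    have 1: "m \<in> edge_segment (border (x, y) (x, y + 1))" by (simp add: border_simps edge_segment_horizontal m_def)
    have 2: "ball m (1/2) \<subseteq> open_square (x, y) \<union> open_square (x, y + 1) \<union> edge_segment (border (x, y) (x, y + 1))"
    proof
      fix z assume "z \<in> ball m (1/2)"
      from ball[OF this] have h: "real_of_int y + 1/2 < Im z" "Im z < real_of_int y + 3/2"
        "real_of_int x < Re z" "Re z < real_of_int x + 1" unfolding m_def complex.sel by linarith+
      consider "Im z < real_of_int y + 1" | "Im z = real_of_int y + 1" | "Im z > real_of_int y + 1" by linarith
      then show "z \<in> open_square (x, y) \<union> open_square (x, y + 1) \<union> edge_segment (border (x, y) (x, y + 1))"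
      proof cases
        case 1
        then have "z \<in> open_square (x, y)" unfolding in_open_square_iff using h by simp
        then show ?thesis by blast
      next
        case 2
        then have "z \<in> edge_segment (border (x, y) (x, y + 1))" unfolding border_simps edge_segment_horizontal using h by simp
        then show ?thesis by blast
      next
        case 3
        then have "z \<in> open_square (x, y + 1)" unfolding in_open_square_iff using h by simp
        then show ?thesis by blast
      qed
    qed
    have 3: "Complex (Re m) (Im m - 1/4) \<in> open_square (x, y)" "Complex (Re m) (Im m + 1/4) \<in> open_square (x, y + 1)"
      by (simp_all add: m_def squares_iff)
    have "pt v \<notin> ball m (1/2)" for v
    proof
      assume "pt v \<in> ball m (1/2)"
      from ball[OF this] have "\<bar>real_of_int (fst v) - (real_of_int x + 1/2)\<bar> < 1/2" by (simp add: pt_def m_def)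
      then have "real_of_int x < real_of_int (fst v)" "real_of_int (fst v) < real_of_int (x + 1)"
        unfolding abs_less_iff of_int_add by linarith+
      then show False unfolding of_int_less_iff by linarith
    qed
    then have 4: "ball m (1/2) \<inter> range pt = {}" by blast
    have "ball m (1/2) \<inter> open_square (x, y) \<noteq> {}" "ball m (1/2) \<inter> open_square (x, y + 1) \<noteq> {}"
      using 3 ballI[of m] by blast+
    with 1 2 4 have "P (x, y) (x, y + 1) m" unfolding P_def by (intro conjI)
    then show ?thesis ..
  qed
  obtain x y where s: "s = (x, y)" by force
  consider "t = (x + 1, y)" | "t = (x - 1, y)" | "t = (x, y + 1)" | "t = (x, y - 1)"
    using assms s by auto
  then have "\<exists>m. P s t m"
  proof cases
    case 1
    then show ?thesis using vert[of x y] s by simp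
  next
    case 2
    from vert[of "x - 1" y] have "\<exists>m. P (x - 1, y) (x, y) m" by simp
    then show ?thesis unfolding 2 s using P_sym by blast
  next
    case 3
    then show ?thesis using horz[of x y] s by simp
  next
    case 4
    from horz[of x "y - 1"] have "\<exists>m. P (x, y - 1) (x, y) m" by simp
    then show ?thesis unfolding 4 s using P_sym by blast
  qed
  then obtain m where "P s t m" ..
  then show thesis unfolding P_def by (elim conjE) (rule that)
qed

section \<open>The faces enclosed by a lattice polygon\<close>

definition faces :: "(int \<times> int) list \<Rightarrow> (int \<times> int) set" where
  "faces \<alpha> = {s. open_square s \<subseteq> inside (loop_curve \<alpha>)}"

definition lattice_lines :: "complex set" where
  "lattice_lines = (\<Union>k :: int. {z. Re z = real_of_int k} \<union> {z. Im z = real_of_int k})"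

lemma negligible_lattice_lines: "negligible lattice_lines"
proof -
  have "negligible {z :: complex. Re z = c}" for c
    using negligible_hyperplane[of "1 :: complex" c] by (simp add: inner_complex_def)
  moreover have "negligible {z :: complex. Im z = c}" for c
    using negligible_hyperplane[of \<i> c] by (simp add: inner_complex_def)
  ultimately have "negligible ({z. Re z = real_of_int k} \<union> {z. Im z = real_of_int k})" for k
    by (intro negligible_Un)
  then have "negligible (\<Union>(range (\<lambda>k. {z. Re z = real_of_int k} \<union> {z. Im z = real_of_int k})))"
    by (intro negligible_countable_Union) auto
  then show ?thesis unfolding lattice_lines_def .
qed

text \<open>
  Up to the lattice lines, which have measure zero, the plane is the disjoint union of the open squares.
\<close>

lemma open_square_cover: "z \<in> lattice_lines \<or> (\<exists>s. z \<in> open_square s)"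
proof (cases "z \<in> lattice_lines")
  case False
  then have "Re z \<noteq> real_of_int \<lfloor>Re z\<rfloor>" "Im z \<noteq> real_of_int \<lfloor>Im z\<rfloor>"
    unfolding lattice_lines_def by blast+
  then have "z \<in> open_square (\<lfloor>Re z\<rfloor>, \<lfloor>Im z\<rfloor>)" unfolding in_open_square_iff by linarith
  then show ?thesis by blast
qed simp

lemma open_square_disjoint_lines: "open_square s \<inter> lattice_lines = {}"
proof -
  obtain x y where s: "s = (x, y)" by force
  have "z \<notin> lattice_lines" if z: "z \<in> open_square (x, y)" for z
  proof
    assume "z \<in> lattice_lines"
    then obtain k :: int where "Re z = real_of_int k \<or> Im z = real_of_int k"
      unfolding lattice_lines_def by blast
    moreover have "real_of_int x < Re z" "Re z < real_of_int (x + 1)" "real_of_int y < Im z" "Im z < real_of_int (y + 1)"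
      using z unfolding in_open_square_iff by simp_all
    ultimately have "x < k \<and> k < x + 1 \<or> y < k \<and> k < y + 1" by (metis of_int_less_iff)
    then show False by linarith
  qed
  then show ?thesis unfolding s by blast
qed

lemma open_square_disjoint: "z \<in> open_square s \<Longrightarrow> z \<in> open_square t \<Longrightarrow> s = t"
proof -
  obtain x y x' y' where st: "s = (x, y)" "t = (x', y')" by force
  assume "z \<in> open_square s" "z \<in> open_square t"
  then have "x = x'" "y = y'" unfolding st in_open_square_iff by linarith+
  then show "s = t" unfolding st by simp
qed

lemma edge_segment_lattice_lines: "e \<in> lattice_edges \<Longrightarrow> edge_segment e \<subseteq> lattice_lines"
  by (erule lattice_edges_cases) (auto simp: edge_segment_horizontal edge_segment_vertical lattice_lines_def)

lemma loop_edges_lattice: "simple_closed_loop \<alpha> \<Longrightarrow> loop_edges \<alpha> \<subseteq> lattice_edges"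
  unfolding simple_closed_loop_def by (rule cycle_in_loop_edges)

lemma open_square_content: "measure lebesgue (open_square s) = 1" and open_square_lmeasurable: "open_square s \<in> lmeasurable"
proof -
  obtain x y where s: "s = (x, y)" by force
  show "measure lebesgue (open_square s) = 1"
    unfolding s open_square.simps by (simp add: measure_lborel_box_eq Basis_complex_def pt_def)
  show "open_square s \<in> lmeasurable" unfolding s open_square.simps by simp
qed

locale lattice_loop =
  fixes \<alpha> :: "(int \<times> int) list"
  assumes loop: "simple_closed_loop \<alpha>"
begin

abbreviation "curve \<equiv> loop_curve \<alpha>"
abbreviation "I \<equiv> inside (loop_curve \<alpha>)"
abbreviation "O' \<equiv> outside (loop_curve \<alpha>)"

lemma jordan:
  "open I" "open O'" "connected O'" "bounded I" "\<not> bounded O'" "I \<inter> O' = {}" "I \<union> O' = - curve"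
  "frontier I = curve" "frontier O' = curve"
proof -
  obtain c where c: "simple_path c" "pathfinish c = pathstart c" "path_image c = curve"
    using loop_simple_path[OF loop] .
  note J = Jordan_inside_outside[OF c(1,2), unfolded c(3)]
  show "open I" "open O'" "connected O'" "bounded I" "\<not> bounded O'" "I \<inter> O' = {}" "I \<union> O' = - curve"
    "frontier I = curve" "frontier O' = curve" using J by simp_all
qed

lemma curve_lines: "curve \<subseteq> lattice_lines"
  unfolding loop_curve_eq using edge_segment_lattice_lines loop_edges_lattice[OF loop] by blast

lemma connected_one_side:
  assumes "connected A" "A \<inter> curve = {}" "z \<in> A" "z \<in> I"
  shows "A \<subseteq> I"
proof -
  have "A \<subseteq> I \<union> O'" using assms(2) jordan(7) by blast
  then have "I \<inter> A = {} \<or> O' \<inter> A = {}"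
    using connectedD[OF assms(1) jordan(1,2)] jordan(6) by blast
  then show ?thesis using assms(3,4) \<open>A \<subseteq> I \<union> O'\<close> by blast
qed

text \<open>
  Every open square lies entirely inside or entirely outside the polygon, being connected and disjoint
  from it. The faces are thus determined by looking at a single point of each square.
\<close>

lemma face_iff: "z \<in> open_square s \<Longrightarrow> s \<in> faces \<alpha> \<longleftrightarrow> z \<in> I"
  using connected_one_side[OF open_square_connected, of s z] open_square_disjoint_lines[of s] curve_lines
  unfolding faces_def by blast

lemma not_face_iff: "z \<in> open_square s \<Longrightarrow> s \<notin> faces \<alpha> \<longleftrightarrow> z \<in> O'"
  using face_iff[of z s] open_square_disjoint_lines[of s] curve_lines jordan(6,7) by blast

text \<open>
  The ball of \<open>border_crossing_ball\<close> misses the curve, because distinct lattice edges meet in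
  lattice points only. So it lies on one side of the curve.
\<close>

lemma border_off_loop:
  assumes st: "t \<in> nbrs s" and off: "border s t \<notin> loop_edges \<alpha>"
  shows "s \<in> faces \<alpha> \<longleftrightarrow> t \<in> faces \<alpha>"
    and "edge_segment (border s t) \<subseteq> curve \<union> I \<Longrightarrow> s \<in> faces \<alpha>"
proof -
  obtain m where m: "m \<in> edge_segment (border s t)" "ball m (1/2) \<subseteq> open_square s \<union> open_square t \<union> edge_segment (border s t)"
    "ball m (1/2) \<inter> open_square s \<noteq> {}" "ball m (1/2) \<inter> open_square t \<noteq> {}" "ball m (1/2) \<inter> range pt = {}"
    by (rule border_crossing_ball[OF st])
  have seg: "edge_segment (border s t) \<inter> curve \<subseteq> range pt"
  proof
    fix z assume "z \<in> edge_segment (border s t) \<inter> curve"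
    then obtain e where e: "e \<in> loop_edges \<alpha>" "z \<in> edge_segment e" "z \<in> edge_segment (border s t)"
      unfolding loop_curve_eq by blast
    then have "e \<in> lattice_edges" "border s t \<noteq> e" using loop_edges_lattice[OF loop] off by blast+
    then show "z \<in> range pt" using edge_segment_Int[OF border_lattice[OF st]] e by blast
  qed
  have dis: "ball m (1/2) \<inter> curve = {}"
  proof (rule ccontr)
    assume "ball m (1/2) \<inter> curve \<noteq> {}"
    then obtain z where z: "z \<in> ball m (1/2)" "z \<in> curve" by blast
    then have "z \<notin> open_square s" "z \<notin> open_square t" using curve_lines open_square_disjoint_lines by blast+
    then have "z \<in> range pt" using m(2) z seg by blast
    then show False using m(5) z(1) by blast
  qed
  have all: "ball m (1/2) \<subseteq> I" if "z \<in> ball m (1/2)" "z \<in> I" for z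
    using connected_one_side[OF connected_ball dis that] .
  obtain a b where ab: "a \<in> ball m (1/2)" "a \<in> open_square s" "b \<in> ball m (1/2)" "b \<in> open_square t"
    using m(3,4) by blast
  show "s \<in> faces \<alpha> \<longleftrightarrow> t \<in> faces \<alpha>"
    using face_iff[OF ab(2)] face_iff[OF ab(4)] all ab(1,3) by blast
  show "s \<in> faces \<alpha>" if "edge_segment (border s t) \<subseteq> curve \<union> I"
  proof -
    have "m \<in> ball m (1/2)" by simp
    moreover have "m \<in> I" using that m(1) dis \<open>m \<in> ball m (1/2)\<close> by blast
    ultimately have "a \<in> I" using all ab(1) by blast
    then show ?thesis using face_iff[OF ab(2)] by blast
  qed
qed

text \<open>
  By the Jordan curve theorem every point of the curve is a limit of inside and of outside points. Near
  the midpoint of an edge these can only lie in the two adjacent squares.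
\<close>

lemma border_on_loop:
  assumes st: "t \<in> nbrs s" and on: "border s t \<in> loop_edges \<alpha>"
  shows "s \<in> faces \<alpha> \<longleftrightarrow> t \<notin> faces \<alpha>"
proof -
  obtain m where m: "m \<in> edge_segment (border s t)" "ball m (1/2) \<subseteq> open_square s \<union> open_square t \<union> edge_segment (border s t)"
    by (rule border_crossing_ball[OF st])
  have sub: "edge_segment (border s t) \<subseteq> curve" unfolding loop_curve_eq using on by blast
  have "m \<in> frontier I" "m \<in> frontier O'" using m(1) sub jordan(8,9) by blast+
  then have "\<exists>a\<in>I. dist m a < 1/2" "\<exists>b\<in>O'. dist m b < 1/2"
    unfolding frontier_straddle by (auto dest!: spec[of _ "1/2"])
  then obtain a b where ab: "a \<in> ball m (1/2)" "a \<in> I" "b \<in> ball m (1/2)" "b \<in> O'"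
    unfolding mem_ball by blast
  have "a \<notin> curve" "b \<notin> curve" using ab jordan(7) by blast+
  then have "a \<in> open_square s \<union> open_square t" "b \<in> open_square s \<union> open_square t" using ab m(2) sub by blast+
  then show ?thesis using face_iff not_face_iff ab(2,4) by blast
qed

lemma face_closure:
  assumes "s \<in> faces \<alpha>"
  shows "closed_square s \<subseteq> curve \<union> I"
proof -
  have "closed_square s \<subseteq> closure I"
    unfolding closure_open_square[symmetric] using assms unfolding faces_def by (intro closure_mono) blast
  then show ?thesis using jordan(8) closure_Un_frontier[of I] by blast
qed

text \<open>
  A lattice edge on the loop is a side of exactly one face, and an enclosed edge off the loop is a side of
  two faces. Conversely, the closure of a face is contained in the closure of the inside.
\<close>

lemma lattice_edge_enclosed_iff:
  "e \<in> lattice_edges \<and> edge_segment e \<subseteq> curve \<union> I \<longleftrightarrow> (\<exists>s\<in>faces \<alpha>. \<exists>t\<in>nbrs s. e = border s t)"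
proof
  assume e: "e \<in> lattice_edges \<and> edge_segment e \<subseteq> curve \<union> I"
  then have "e \<in> lattice_edges" by simp
  then obtain s t where st: "t \<in> nbrs s" "e = border s t" by (rule lattice_edge_border)
  have st': "s \<in> nbrs t" using st(1) nbrs_sym[of s t] by blast
  have st'': "e = border t s" using st(2) border_sym[of s t] by (rule trans)
  have "s \<in> faces \<alpha> \<or> t \<in> faces \<alpha>"
    using border_on_loop[OF st(1)] border_off_loop(2)[OF st(1)] e st(2) by blast
  then show "\<exists>s\<in>faces \<alpha>. \<exists>t\<in>nbrs s. e = border s t" using st st' st'' by blast
next
  assume "\<exists>s\<in>faces \<alpha>. \<exists>t\<in>nbrs s. e = border s t"
  then obtain s t where "s \<in> faces \<alpha>" "t \<in> nbrs s" "e = border s t" by blast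
  then show "e \<in> lattice_edges \<and> edge_segment e \<subseteq> curve \<union> I"
    using border_lattice[of t s] edge_segment_border_sub[of t s] face_closure[of s] by (simp only:) (meson order_trans)
qed

lemma loop_graph_edges: "uedges (loop_graph \<alpha>) = {border s t |s t. s \<in> faces \<alpha> \<and> t \<in> nbrs s}"
proof (rule Set.set_eqI)
  fix e
  have "e \<in> uedges (loop_graph \<alpha>) \<longleftrightarrow>
      (\<exists>u v. e = {u, v} \<and> {u, v} \<in> lattice_edges \<and> closed_segment (pt u) (pt v) \<subseteq> curve \<union> I)"
    unfolding loop_graph_def ugraph.select_convs mem_Collect_eq ..
  also have "\<dots> \<longleftrightarrow> e \<in> lattice_edges \<and> edge_segment e \<subseteq> curve \<union> I"
  proof
    assume e: "e \<in> lattice_edges \<and> edge_segment e \<subseteq> curve \<union> I"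
    then obtain u v where "e = {u, v}" unfolding lattice_edges_def by blast
    then show "\<exists>u v. e = {u, v} \<and> {u, v} \<in> lattice_edges \<and> closed_segment (pt u) (pt v) \<subseteq> curve \<union> I"
      unfolding edge_segment_doubleton[symmetric] using e by blast
  next
    assume "\<exists>u v. e = {u, v} \<and> {u, v} \<in> lattice_edges \<and> closed_segment (pt u) (pt v) \<subseteq> curve \<union> I"
    then show "e \<in> lattice_edges \<and> edge_segment e \<subseteq> curve \<union> I" unfolding edge_segment_doubleton[symmetric] by blast
  qed
  also have "\<dots> \<longleftrightarrow> (\<exists>s\<in>faces \<alpha>. \<exists>t\<in>nbrs s. e = border s t)" by (rule lattice_edge_enclosed_iff)
  finally show "e \<in> uedges (loop_graph \<alpha>) \<longleftrightarrow> e \<in> {border s t |s t. s \<in> faces \<alpha> \<and> t \<in> nbrs s}"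
    by blast
qed

lemma faces_nonempty: "faces \<alpha> \<noteq> {}"
proof -
  have "length \<alpha> > 0" using loop by (auto simp: simple_closed_loop_def cycle_in_def)
  then obtain e where e: "e \<in> loop_edges \<alpha>" unfolding loop_edges_image by blast
  then have "e \<in> lattice_edges" using loop_edges_lattice[OF loop] by blast
  then obtain s t where "t \<in> nbrs s" "e = border s t" by (rule lattice_edge_border)
  then show ?thesis using border_on_loop[of t s] e by blast
qed

lemma faces_finite: "finite (faces \<alpha>)"
proof -
  obtain B where B: "\<And>z. z \<in> I \<Longrightarrow> norm z \<le> B" using jordan(4) unfolding bounded_iff by blast
  define N where "N = \<lceil>B\<rceil> + 1"
  have "faces \<alpha> \<subseteq> {-N..N} \<times> {-N..N}"
  proof
    fix s assume s: "s \<in> faces \<alpha>"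
    obtain x y where xy: "s = (x, y)" by force
    let ?z = "Complex (real_of_int x + 1/2) (real_of_int y + 1/2)"
    have "?z \<in> open_square s" unfolding xy in_open_square_iff by simp
    then have "norm ?z \<le> B" using s B unfolding faces_def by blast
    then have "\<bar>real_of_int x + 1/2\<bar> \<le> B" "\<bar>real_of_int y + 1/2\<bar> \<le> B"
      using abs_Re_le_cmod[of ?z] abs_Im_le_cmod[of ?z] by simp_all
    moreover have "B \<le> real_of_int N - 1" unfolding N_def by simp
    ultimately have "- real_of_int N \<le> real_of_int x" "real_of_int x \<le> real_of_int N"
      "- real_of_int N \<le> real_of_int y" "real_of_int y \<le> real_of_int N" by linarith+
    then have "-N \<le> x" "x \<le> N" "-N \<le> y" "y \<le> N" by linarith+
    then show "s \<in> {-N..N} \<times> {-N..N}" unfolding xy by simp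
  qed
  then show ?thesis by (rule finite_subset) simp
qed

lemma area_faces: "loop_area \<alpha> = real (card (faces \<alpha>))"
proof -
  let ?U = "\<Union>(open_square ` faces \<alpha>)"
  have inj: "inj_on open_square (faces \<alpha>)"
  proof (rule inj_onI)
    fix s t assume "open_square s = open_square t"
    moreover obtain z where "z \<in> open_square s" using open_square_nonempty by blast
    ultimately show "s = t" using open_square_disjoint[of z s t] by simp
  qed
  have meas: "?U \<in> lmeasurable" using faces_finite open_square_lmeasurable by (intro fmeasurable.finite_Union) auto
  have "?U \<subseteq> I" unfolding faces_def by blast
  moreover have "I - ?U \<subseteq> lattice_lines"
  proof
    fix z assume z: "z \<in> I - ?U"
    then have "z \<notin> open_square s" for s using face_iff[of z s] by blast
    then show "z \<in> lattice_lines" using open_square_cover[of z] by blast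
  qed
  ultimately have "?U - I \<union> (I - ?U) \<subseteq> lattice_lines" by blast
  then have "negligible (?U - I \<union> (I - ?U))"
    by (rule negligible_subset[OF negligible_lattice_lines])
  then have "loop_area \<alpha> = measure lebesgue ?U"
    unfolding loop_area_def by (rule measure_negligible_symdiff[OF meas])
  also have "\<dots> = (\<Sum>S\<in>open_square ` faces \<alpha>. measure lebesgue S)"
  proof (rule measure_negligible_finite_Union)
    show "pairwise (\<lambda>S T. negligible (S \<inter> T)) (open_square ` faces \<alpha>)"
    proof (rule pairwiseI)
      fix S T assume "S \<in> open_square ` faces \<alpha>" "T \<in> open_square ` faces \<alpha>" "S \<noteq> T"
      then have "S \<inter> T = {}" using open_square_disjoint by blast
      then show "negligible (S \<inter> T)" by simp
    qed
  qed (use faces_finite open_square_lmeasurable in auto)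
  also have "\<dots> = real (card (faces \<alpha>))"
    by (simp add: sum.reindex[OF inj] open_square_content)
  finally show ?thesis .
qed

text \<open>
  The outside of \<open>\<alpha>\<close> is connected, unbounded and disjoint from the curve of \<open>p\<close>, so no part of it lies
  inside \<open>p\<close>.
\<close>

lemma faces_subset_of_enclosed:
  assumes p: "cycle_in (uedges (loop_graph \<alpha>)) p"
  shows "simple_closed_loop p" "faces p \<subseteq> faces \<alpha>"
proof -
  have E: "uedges (loop_graph \<alpha>) \<subseteq> lattice_edges" unfolding loop_graph_edges using border_lattice by blast
  show loop': "simple_closed_loop p" unfolding simple_closed_loop_def by (rule cycle_in_mono[OF p E])
  interpret p: lattice_loop p by standard (rule loop')
  have "edge_segment e \<subseteq> curve \<union> I" if "e \<in> loop_edges p" for e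
  proof -
    have "e \<in> uedges (loop_graph \<alpha>)" using cycle_in_loop_edges[OF p] that by blast
    then show ?thesis unfolding loop_graph_edges using lattice_edge_enclosed_iff[of e] by blast
  qed
  then have "loop_curve p \<subseteq> curve \<union> I" unfolding loop_curve_eq[of p] by blast
  then have dis: "O' \<inter> loop_curve p = {}" using jordan(6,7) by blast
  have out: "O' \<inter> p.I = {}"
  proof (rule ccontr)
    assume "O' \<inter> p.I \<noteq> {}"
    then obtain z where "z \<in> O'" "z \<in> p.I" by blast
    then have "O' \<subseteq> p.I" using p.connected_one_side[OF jordan(3) dis] by blast
    then show False using p.jordan(4) jordan(5) bounded_subset by blast
  qed
  show "faces p \<subseteq> faces \<alpha>"
  proof (intro subsetI, rule ccontr)
    fix s assume s: "s \<in> faces p" "s \<notin> faces \<alpha>"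
    obtain z where z: "z \<in> open_square s" using open_square_nonempty by blast
    then have "z \<in> p.I" "z \<in> O'" using p.face_iff not_face_iff s by blast+
    then show False using out by blast
  qed
qed

end

lemma bounded_by_loop_region:
  assumes "bounded_by_loop H \<beta>"
  shows "region (faces \<beta>) (uverts H) (uedges H)"
proof -
  have grid: "grid_graph H" and loop: "simple_closed_loop \<beta>" and H: "H = loop_graph \<beta>"
    using assms unfolding bounded_by_loop_def by auto
  interpret lattice_loop \<beta> by standard (rule loop)
  have edges: "uedges H = {border s t |s t. s \<in> faces \<beta> \<and> t \<in> nbrs s}"
    unfolding H by (rule loop_graph_edges)
  show ?thesis
  proof
    show "finite (faces \<beta>)" by (rule faces_finite)
    show "finite (uverts H)" "\<Union> (uedges H) \<subseteq> uverts H"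
      using grid unfolding grid_graph_def by blast+
    show "ugraph_connected \<lparr>uverts = uverts H, uedges = uedges H\<rparr>"
    proof -
      have H_eq: "\<lparr>uverts = uverts H, uedges = uedges H\<rparr> = H" by (cases H) simp
      show ?thesis unfolding H_eq using grid unfolding grid_graph_def by blast
    qed
    show "uedges H = {border s t |s t. s \<in> faces \<beta> \<and> t \<in> nbrs s}" by (rule edges)
    fix p assume p: "cycle_in (uedges H) p"
    note sub = faces_subset_of_enclosed[OF p[unfolded H]]
    interpret p: lattice_loop p by standard (rule sub(1))
    have "border s t \<in> loop_edges p" if "s \<in> faces p" "t \<in> nbrs s" "t \<notin> faces p" for s t
      using p.border_off_loop(1)[OF that(2)] that(1,3) by blast
    then show "\<exists>Y\<subseteq>faces \<beta>. Y \<noteq> {} \<and> (\<forall>s\<in>Y. \<forall>t\<in>nbrs s. t \<notin> Y \<longrightarrow> border s t \<in> loop_edges p)"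
      using sub(2) p.faces_nonempty by blast
  qed
qed

lemma bounded_by_loop_invariants:
  assumes "bounded_by_loop H \<beta>"
  shows "loop_area \<beta> = real (card (faces \<beta>))"
    and "finite (uverts H)" and "finite (uedges H)" and "finite (faces \<beta>)"
    and "card (uedges H) + 1 = card (uverts H) + card (faces \<beta>)"
    and "\<tau> H = card {f \<in> PiE (faces \<beta>) nbrs. ranked (faces \<beta>) f}"
proof -
  interpret region "faces \<beta>" "uverts H" "uedges H" by (rule bounded_by_loop_region[OF assms])
  interpret lattice_loop \<beta>
    using assms unfolding bounded_by_loop_def by unfold_locales blast
  show "loop_area \<beta> = real (card (faces \<beta>))" by (rule area_faces)
  show "finite (uverts H)" "finite (uedges H)" "finite (faces \<beta>)" by (rule finV finE finF)+
  show "card (uedges H) + 1 = card (uverts H) + card (faces \<beta>)" by (rule euler)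
  show "\<tau> H = card {f \<in> PiE (faces \<beta>) nbrs. ranked (faces \<beta>) f}"
  proof -
    have H_eq: "\<lparr>uverts = uverts H, uedges = uedges H\<rparr> = H" by (cases H) simp
    show ?thesis using spanning_trees_eq unfolding H_eq .
  qed
qed

section \<open>Spanning trees and cut edges of simple grid graphs\<close>

text \<open>
  The sum of an alternating series with decreasing terms is at least its second partial sum.
\<close>

lemma catalan_pos: "0 < catalan_const"
proof -
  let ?a = "\<lambda>n. 1 / (2 * real n + 1)\<^sup>2"
  have "?a \<longlonglongrightarrow> 0" by real_asymp
  moreover have "0 \<le> ?a n" for n by simp
  moreover have "?a (Suc n) \<le> ?a n" for n
    by (intro divide_left_mono power_mono) auto
  ultimately have "(\<Sum>i<2 * 1. (-1) ^ i * ?a i) \<le> (\<Sum>i. (-1) ^ i * ?a i)"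
    by (rule summable_Leibniz'(2))
  also have "(\<Sum>i. (-1) ^ i * ?a i) = catalan_const" by (simp add: catalan_const_def)
  finally show ?thesis by (simp add: numeral_2_eq_2)
qed

lemma ln_bb_pos: "0 < ln \<bb>"
  using catalan_pos by (simp add: \<bb>_def)

lemma log_spanning_trees_bounds:
  assumes "bounded_by_loop H \<beta>"
  shows "0 < \<tau> H"
    and "real (card (faces \<beta>)) * ln \<bb> \<le> ln (real (\<tau> H))"
    and "ln (real (\<tau> H)) \<le> real (card (faces \<beta>)) * ln 4"
proof -
  note inv = bounded_by_loop_invariants[OF assms]
  have bb: "0 < \<bb>" by (simp add: \<bb>_def)
  have lower: "\<bb> ^ card (faces \<beta>) \<le> real (\<tau> H)"
    unfolding inv(6) by (rule card_ranked_lower[OF inv(4)])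
  have pos: "0 < \<bb> ^ card (faces \<beta>)" using bb by simp
  have tpos: "0 < real (\<tau> H)" using lower pos by linarith
  then show "0 < \<tau> H" by simp
  have "ln (\<bb> ^ card (faces \<beta>)) \<le> ln (real (\<tau> H))" using lower pos by simp
  then show "real (card (faces \<beta>)) * ln \<bb> \<le> ln (real (\<tau> H))" using bb by (simp add: ln_realpow)
  have "real (\<tau> H) \<le> real (4 ^ card (faces \<beta>))"
    unfolding inv(6) using card_ranked_upper[OF inv(4)] by (rule of_nat_mono)
  then have "ln (real (\<tau> H)) \<le> ln (4 ^ card (faces \<beta>))" using tpos by simp
  then show "ln (real (\<tau> H)) \<le> real (card (faces \<beta>)) * ln 4" by (simp add: ln_realpow)
qed

lemma card_edges_partition:
  assumes fin: "finite (uedges G)" and edge: "\<And>e. e \<in> uedges G \<Longrightarrow> \<exists>u v. e = {u, v} \<and> u \<in> uverts G \<and> v \<in> uverts G"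
    and finI: "finite I" and cover: "uverts G = (\<Union>i\<in>I. V i)"
    and disj: "\<And>i j. i \<in> I \<Longrightarrow> j \<in> I \<Longrightarrow> i \<noteq> j \<Longrightarrow> V i \<inter> V j = {}"
  shows "card (uedges G) = card (cut_edges G I V) + (\<Sum>i\<in>I. card (uedges (induced_ugraph G (V i))))"
proof -
  define E where "E = (\<lambda>i. {e \<in> uedges G. e \<subseteq> V i})"
  have cutE: "cut_edges G I V \<subseteq> uedges G" unfolding cut_edges_def by blast
  have ne: "e \<noteq> {}" if "e \<in> uedges G" for e using edge[OF that] by blast
  have "uedges G = cut_edges G I V \<union> (\<Union>i\<in>I. E i)"
  proof
    show "uedges G \<subseteq> cut_edges G I V \<union> (\<Union>i\<in>I. E i)"
    proof
      fix e assume e: "e \<in> uedges G"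
      then obtain u v where uv: "e = {u, v}" "u \<in> uverts G" "v \<in> uverts G" using edge by blast
      then obtain i j where ij: "i \<in> I" "u \<in> V i" "j \<in> I" "v \<in> V j" unfolding cover by blast
      show "e \<in> cut_edges G I V \<union> (\<Union>i\<in>I. E i)"
      proof (cases "i = j")
        case True
        then have "e \<in> E i" unfolding E_def using e uv ij by simp
        then show ?thesis using ij by blast
      next
        case False
        then have "e \<in> cut_edges G I V" unfolding cut_edges_def uv(1) using e uv(1) ij by blast
        then show ?thesis by blast
      qed
    qed
    show "cut_edges G I V \<union> (\<Union>i\<in>I. E i) \<subseteq> uedges G" using cutE unfolding E_def by blast
  qed
  moreover have "cut_edges G I V \<inter> (\<Union>i\<in>I. E i) = {}"
  proof (rule ccontr)
    assume "\<not> ?thesis"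
    then obtain e k where e: "e \<in> cut_edges G I V" "k \<in> I" "e \<subseteq> V k" unfolding E_def by blast
    then obtain u v i j where "e = {u, v}" "i \<in> I" "j \<in> I" "i \<noteq> j" "u \<in> V i" "v \<in> V j"
      unfolding cut_edges_def by blast
    then have "i = k" "j = k" using disj[of i k] disj[of j k] e(2,3) by blast+
    then show False using \<open>i \<noteq> j\<close> by simp
  qed
  moreover have "card (\<Union>i\<in>I. E i) = (\<Sum>i\<in>I. card (E i))"
  proof (rule card_UN_disjoint[OF finI])
    show "\<forall>i\<in>I. finite (E i)" unfolding E_def using fin by simp
    show "\<forall>i\<in>I. \<forall>j\<in>I. i \<noteq> j \<longrightarrow> E i \<inter> E j = {}"
    proof (intro ballI impI, rule ccontr)
      fix i j assume ij: "i \<in> I" "j \<in> I" "i \<noteq> j" "E i \<inter> E j \<noteq> {}"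
      then obtain e where "e \<in> uedges G" "e \<subseteq> V i" "e \<subseteq> V j" unfolding E_def by blast
      then show False using disj[OF ij(1-3)] ne by blast
    qed
  qed
  moreover have "finite (cut_edges G I V)" using cutE fin by (rule finite_subset)
  moreover have "finite (\<Union>i\<in>I. E i)" unfolding E_def using fin finI by simp
  moreover have "uedges (induced_ugraph G (V i)) = E i" for i
    by (simp add: induced_ugraph_def E_def)
  ultimately show ?thesis by (simp add: card_Un_disjoint)
qed

theorem mainTheorem4:
  fixes G :: "(int \<times> int) ugraph"
    and \<alpha> :: "(int \<times> int) list"
    and K :: nat
    and V :: "nat \<Rightarrow> (int \<times> int) set"
    and C\<^sub>1 :: real
  assumes "bounded_by_loop G \<alpha>"
    and "partition_on (uverts G) (V ` {1..K})"
    and "inj_on V {1..K}"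
    and "\<And>i. i \<in> {1..K} \<Longrightarrow> simple_grid_graph (induced_ugraph G (V i))"
  defines "C\<^sub>1 \<equiv> loop_area \<alpha> + real K - 1"
  shows "C\<^sub>1 - 1 / ln \<bb> * ln (real (\<Prod>i=1..K. \<tau> (induced_ugraph G (V i))))
           \<le> real (card (cut_edges G {1..K} V))
       \<and> real (card (cut_edges G {1..K} V))
           \<le> C\<^sub>1 - 1 / ln 4 * ln (real (\<Prod>i=1..K. \<tau> (induced_ugraph G (V i))))"
proof -
  let ?H = "\<lambda>i. induced_ugraph G (V i)"
  note invG = bounded_by_loop_invariants[OF assms(1)]
  interpret region "faces \<alpha>" "uverts G" "uedges G" by (rule bounded_by_loop_region[OF assms(1)])
  have "\<forall>i\<in>{1..K}. \<exists>\<beta>. bounded_by_loop (?H i) \<beta>"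
    using assms(4) unfolding simple_grid_graph_def by blast
  then obtain \<beta> where \<beta>: "\<And>i. i \<in> {1..K} \<Longrightarrow> bounded_by_loop (?H i) (\<beta> i)" by metis
  define F where "F = (\<lambda>i. card (faces (\<beta> i)))"
  note inv = bounded_by_loop_invariants[OF \<beta>]
  note bounds = log_spanning_trees_bounds[OF \<beta>]
  have cover: "uverts G = (\<Union>i\<in>{1..K}. V i)"
    using assms(2) unfolding partition_on_def by blast
  have disj: "V i \<inter> V j = {}" if "i \<in> {1..K}" "j \<in> {1..K}" "i \<noteq> j" for i j
  proof -
    have "V i \<noteq> V j" using inj_onD[OF assms(3)] that by blast
    then show ?thesis using assms(2) that unfolding partition_on_def disjoint_def by blast
  qed
  have edge: "\<exists>u v. e = {u, v} \<and> u \<in> uverts G \<and> v \<in> uverts G" if "e \<in> uedges G" for e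
    using E_doubleton[OF that] E_V that by blast
  have cut: "card (uedges G) = card (cut_edges G {1..K} V) + (\<Sum>i=1..K. card (uedges (?H i)))"
    using card_edges_partition[OF invG(3) edge finite_atLeastAtMost cover disj] .
  have verts: "uverts (?H i) = V i" if "i \<in> {1..K}" for i
    using that cover by (auto simp: induced_ugraph_def)
  have "card (uverts G) = (\<Sum>i=1..K. card (V i))"
    unfolding cover
  proof (rule card_UN_disjoint)
    show "\<forall>i\<in>{1..K}. finite (V i)" using invG(2) cover by (simp add: finite_UN)
  qed (use disj in auto)
  also have "\<dots> = (\<Sum>i=1..K. card (uverts (?H i)))" by (simp add: verts)
  finally have "card (uverts G) + (\<Sum>i=1..K. F i) = (\<Sum>i=1..K. card (uverts (?H i)) + F i)"
    unfolding sum.distrib by simp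
  also have "\<dots> = (\<Sum>i=1..K. card (uedges (?H i)) + 1)"
    unfolding F_def by (rule sum.cong[OF refl]) (rule inv(5)[symmetric])
  also have "\<dots> = (\<Sum>i=1..K. card (uedges (?H i))) + K" unfolding sum.distrib by simp
  finally have "card (uverts G) + (\<Sum>i=1..K. F i) = (\<Sum>i=1..K. card (uedges (?H i))) + K" .
  with cut invG(5) have "card (cut_edges G {1..K} V) + 1 + (\<Sum>i=1..K. F i) = card (faces \<alpha>) + K"
    by linarith
  from arg_cong[OF this, of real]
  have cut_eq: "real (card (cut_edges G {1..K} V)) = C\<^sub>1 - (\<Sum>i=1..K. real (F i))"
    unfolding C\<^sub>1_def invG(1) by simp
  have ln_prod: "ln (real (\<Prod>i=1..K. \<tau> (?H i))) = (\<Sum>i=1..K. ln (real (\<tau> (?H i))))"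
    unfolding of_nat_prod by (rule ln_prod) (use bounds(1) in auto)
  have "(\<Sum>i=1..K. real (F i)) * ln \<bb> \<le> (\<Sum>i=1..K. ln (real (\<tau> (?H i))))"
    unfolding sum_distrib_right F_def by (rule sum_mono) (rule bounds(2))
  then have lower: "(\<Sum>i=1..K. real (F i)) \<le> 1 / ln \<bb> * (\<Sum>i=1..K. ln (real (\<tau> (?H i))))"
    using ln_bb_pos by (simp add: pos_le_divide_eq)
  have "(\<Sum>i=1..K. ln (real (\<tau> (?H i)))) \<le> (\<Sum>i=1..K. real (F i)) * ln 4"
    unfolding sum_distrib_right F_def by (rule sum_mono) (rule bounds(3))
  then have upper: "1 / ln 4 * (\<Sum>i=1..K. ln (real (\<tau> (?H i)))) \<le> (\<Sum>i=1..K. real (F i))"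
    by (simp add: pos_divide_le_eq)
  show ?thesis unfolding ln_prod cut_eq using lower upper by linarith
qed

end
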